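(* Let $d\ge2$ be an integer, $0<\sigma<1$ and $v\in\mathbb{R}$. Assume that $y\in C^2_1(\mathbb{R},\mathbb{R}^d)$ defines a regular simple closed curve. Then $y$ is an extremal of the functional $$\mathcal{A}^\sigma(y)=\int_0^1\frac{v^2}{2}\|\dot y(s)\|^2\,ds+\frac12\int_0^1\int_0^1\frac{dr\,ds}{\|y(s)-y(r)\|^\sigma}$$ if and only if it satisfies $$v^2\ddot y(s)=-\lim_{\delta\to0^+}\int_{s+\delta}^{1+s-\delta}\sigma\,\frac{y(s)-y(r)}{\|y(s)-y(r)\|^{2+\sigma}}\,dr\qquad\text{for all } s\in\mathbb{R}.$$
   Context: $\|\cdot\|$ is the Euclidean norm on $\mathbb{R}^d$. $C^2_1(\mathbb{R},\mathbb{R}^d)$ denotes the set of $1$-periodic functions in $C^2(\mathbb{R},\mathbb{R}^d)$. Such a $y$ defines a regular simple closed curve if $\dot y(s)\neq0$ for all $s$ and $y$ is injective on $[0,1)$. The function $y$ is an extremal of $\mathcal{A}^\sigma$ if $$\frac{d}{d\varepsilon}\mathcal{A}^\sigma(y+\varepsilon z)\Big|_{\varepsilon=0}=0$$ for every $z\in C^2_1(\mathbb{R},\mathbb{R}^d)$, where $\mathcal{A}^\sigma$ is evaluated by the formula in the statement. *)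

theory Defs
  imports "HOL-Analysis.Analysis"
begin

definition C2_periodic :: "(real \<Rightarrow> real ^ 'd) set" where
  "C2_periodic = {y.
     (\<forall>s. y differentiable (at s)) \<and>
     (\<lambda>s. vector_derivative y (at s)) C1_differentiable_on UNIV \<and>
     (\<forall>s. y (s + 1) = y s)}"

definition regular_simple_closed_curve :: "(real \<Rightarrow> real ^ 'd) \<Rightarrow> bool" where
  "regular_simple_closed_curve y \<longleftrightarrow>
     (\<forall>s. vector_derivative y (at s) \<noteq> 0) \<and> inj_on y {0..<1}"

text \<open>
  The second integrand is singular on the diagonal \<open>r = s\<close>, where division by zero makes it
  \<open>0\<close>; for each \<open>s\<close> this changes it at one point \<open>r\<close> only. If an integral diverges, the
  Lebesgue integral below has the conventional value \<open>0\<close>; this does not happen for regular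
  simple closed curves of class \<open>C\<^sup>2\<close>, nor for their small perturbations, which are the
  only arguments on which the derivative in \<open>is_extremal\<close> depends.
\<close>
definition action :: "real \<Rightarrow> real \<Rightarrow> (real \<Rightarrow> real ^ 'd) \<Rightarrow> real" where
  "action v \<sigma> y =
     (LINT s:{0..1}|lborel. v\<^sup>2 / 2 * (norm (vector_derivative y (at s)))\<^sup>2) +
     1 / 2 * (LINT s:{0..1}|lborel. (LINT r:{0..1}|lborel. 1 / norm (y s - y r) powr \<sigma>))"

definition is_extremal :: "real \<Rightarrow> real \<Rightarrow> (real \<Rightarrow> real ^ 'd) \<Rightarrow> bool" where
  "is_extremal v \<sigma> y \<longleftrightarrow>
     (\<forall>z \<in> C2_periodic.
        ((\<lambda>\<epsilon>. action v \<sigma> (\<lambda>s. y s + \<epsilon> *\<^sub>R z s)) has_real_derivative 0) (at 0))"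

end

theory Submission
  imports Defs
begin

text \<open>
  A regular simple closed curve satisfies a chord-arc bound
  \<open>|y (s + h) - y s| \<ge> c h\<close> for \<open>0 \<le> h \<le> 1/2\<close>, which is stable under small perturbations
  \<open>y + \<epsilon> z\<close>. By periodicity the double integral runs over \<open>s \<in> [0, 1]\<close> and the two points
  \<open>r = s \<plusminus> h\<close> with \<open>0 \<le> h \<le> 1/2\<close>; there the \<open>\<epsilon>\<close>-difference quotients are dominated by
  \<open>C h\<^sup>-\<^sup>\<sigma>\<close>, so one may differentiate under the integral. Exchanging the integrals and, for each
  fixed \<open>h\<close>, translating \<open>s\<close> by \<open>\<plusminus>h\<close> moves all increments of \<open>z\<close> onto the kernel and leaves
  \<open>\<integral> \<langle>F, z\<rangle>\<close>, where \<open>F s\<close> integrates the symmetrised kernel over \<open>0 \<le> h \<le> 1/2\<close>. Because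
  the kernel is odd and homogeneous of degree \<open>-1 - \<sigma>\<close>, a second-order Taylor expansion of \<open>y\<close>
  shows that the symmetrised kernel is again \<open>O(h\<^sup>-\<^sup>\<sigma>)\<close>; hence \<open>F\<close> is continuous and equals the
  principal value. The first variation is thus \<open>-\<integral> \<langle>v\<^sup>2 y'' + F, z\<rangle>\<close>, and the fundamental lemma
  with periodic test functions of class \<open>C\<^sup>2\<close> concludes.
\<close>

section \<open>Integrals of shifted, reflected and parameterised functions\<close>

text \<open>With exponent \<open>- \<sigma>\<close>, where \<sigma> < 1, this is the integrability
  of every majorant used below.\<close>

lemma set_integrable_powr_lborel:
  fixes a c :: real
  assumes "a > -1" "c \<ge> 0"
  shows "set_integrable lborel {0..c} (\<lambda>x. x powr a)"
proof -
  have "(\<lambda>x. x powr a) absolutely_integrable_on {0..c}"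
    using assms by (intro nonnegative_absolutely_integrable_1 integrable_on_powr_from_0) auto
  then show ?thesis
    unfolding set_integrable_def
    by (subst (asm) integrable_completion) auto
qed

lemma set_integral_shift:
  fixes g :: "real \<Rightarrow> 'a::{banach, second_countable_topology}"
  shows "set_integrable lborel {t+a..t+b} g \<longleftrightarrow> set_integrable lborel {a..b} (\<lambda>h. g (t + h))"
    and "(LINT x:{t+a..t+b}|lborel. g x) = (LINT h:{a..b}|lborel. g (t + h))"
proof -
  have *: "indicator {t+a..t+b} (t + 1 * h) *\<^sub>R g (t + 1 * h) = indicator {a..b} h *\<^sub>R g (t + h)" for h
    by (auto simp: indicator_def)
  show "set_integrable lborel {t+a..t+b} g \<longleftrightarrow> set_integrable lborel {a..b} (\<lambda>h. g (t + h))"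
    unfolding set_integrable_def
    by (subst lborel_integrable_real_affine_iff[of 1 _ t, symmetric]) (simp, simp only: *)
  show "(LINT x:{t+a..t+b}|lborel. g x) = (LINT h:{a..b}|lborel. g (t + h))"
    unfolding set_lebesgue_integral_def
    by (subst lborel_integral_real_affine[of 1 _ t]) (simp_all only: *, simp_all)
qed

lemma set_integral_reflect_about:
  fixes g :: "real \<Rightarrow> 'a::{banach, second_countable_topology}"
  shows "set_integrable lborel {t-b..t-a} g \<longleftrightarrow> set_integrable lborel {a..b} (\<lambda>h. g (t - h))"
    and "(LINT x:{t-b..t-a}|lborel. g x) = (LINT h:{a..b}|lborel. g (t - h))"
proof -
  have *: "indicator {t-b..t-a} (t + - 1 * h) *\<^sub>R g (t + - 1 * h) = indicator {a..b} h *\<^sub>R g (t - h)" for h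
    by (auto simp: indicator_def)
  show "set_integrable lborel {t-b..t-a} g \<longleftrightarrow> set_integrable lborel {a..b} (\<lambda>h. g (t - h))"
    unfolding set_integrable_def
    by (subst lborel_integrable_real_affine_iff[of "-1" _ t, symmetric]) (simp, simp only: *)
  show "(LINT x:{t-b..t-a}|lborel. g x) = (LINT h:{a..b}|lborel. g (t - h))"
    unfolding set_lebesgue_integral_def
    by (subst lborel_integral_real_affine[of "-1" _ t]) (simp_all only: *, simp_all)
qed

lemma set_integral_combine_Icc:
  fixes g :: "real \<Rightarrow> 'a::{banach, second_countable_topology}"
  assumes "a \<le> b" "b \<le> c" "set_integrable lborel {a..b} g" "set_integrable lborel {b..c} g"
  shows "set_integrable lborel {a..c} g"
    and "(LINT x:{a..c}|lborel. g x) = (LINT x:{a..b}|lborel. g x) + (LINT x:{b..c}|lborel. g x)"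
proof -
  have un: "{a..c} = {a..b} \<union> {b..c}"
    using assms(1,2) by auto
  show "set_integrable lborel {a..c} g"
    unfolding un by (intro set_integrable_Un assms) auto
  have "AE x in lborel. x \<noteq> b"
    by (rule AE_lborel_singleton)
  then show "(LINT x:{a..c}|lborel. g x) = (LINT x:{a..b}|lborel. g x) + (LINT x:{b..c}|lborel. g x)"
    unfolding un by (intro set_integral_Un_AE assms) auto
qed

text \<open>The interval is cut at its midpoint \<open>s + 1/2\<close>; the left half is measured
  forwards from \<open>s\<close>, the right half backwards from \<open>1 + s\<close>. For periodic
  \<open>g\<close> the second point is \<open>s - h\<close>. The case \<delta> = 0 folds a whole
  period, the case \<delta> > 0 the truncated interval of the principal value.\<close>

lemma set_integral_fold_half:
  fixes g :: "real \<Rightarrow> 'a::{banach, second_countable_topology}"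
  assumes "\<delta> \<le> 1/2"
    and p: "set_integrable lborel {\<delta>..1/2} (\<lambda>h. g (s + h))"
    and m: "set_integrable lborel {\<delta>..1/2} (\<lambda>h. g (1 + s - h))"
  shows "set_integrable lborel {s+\<delta>..1+s-\<delta>} g"
    and "(LINT r:{s+\<delta>..1+s-\<delta>}|lborel. g r) = (LINT h:{\<delta>..1/2}|lborel. g (s + h) + g (1 + s - h))"
proof -
  have 1: "set_integrable lborel {s+\<delta>..s+1/2} g"
    using p set_integral_shift(1) by blast
  have "set_integrable lborel {(1+s)-1/2..(1+s)-\<delta>} g"
    using m set_integral_reflect_about(1) by blast
  moreover have half: "(1+s)-1/2 = s+1/2" by simp
  ultimately have 2: "set_integrable lborel {s+1/2..1+s-\<delta>} g" by metis
  show "set_integrable lborel {s+\<delta>..1+s-\<delta>} g"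
    by (rule set_integral_combine_Icc(1)[OF _ _ 1 2]) (use assms(1) in auto)
  have "(LINT r:{s+\<delta>..1+s-\<delta>}|lborel. g r)
      = (LINT r:{s+\<delta>..s+1/2}|lborel. g r) + (LINT r:{s+1/2..1+s-\<delta>}|lborel. g r)"
    by (rule set_integral_combine_Icc(2)[OF _ _ 1 2]) (use assms(1) in auto)
  also have "\<dots> = (LINT h:{\<delta>..1/2}|lborel. g (s + h)) + (LINT h:{\<delta>..1/2}|lborel. g (1 + s - h))"
    unfolding half[symmetric] by (simp only: set_integral_reflect_about(2)) (simp only: half set_integral_shift(2))
  also have "\<dots> = (LINT h:{\<delta>..1/2}|lborel. g (s + h) + g (1 + s - h))"
    using set_integral_add(2)[OF p m] by simp
  finally show "(LINT r:{s+\<delta>..1+s-\<delta>}|lborel. g r) = (LINT h:{\<delta>..1/2}|lborel. g (s + h) + g (1 + s - h))" .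
qed

text \<open>The piece over \<open>{1..1+s}\<close> that sticks out of the unit interval is moved
  back by one period to \<open>{0..s}\<close>.\<close>

lemma set_integral_periodic_shift:
  fixes g :: "real \<Rightarrow> 'a::{banach, second_countable_topology}"
  assumes per: "\<And>x. g (x + 1) = g x" and s: "0 \<le> s" "s \<le> 1"
    and int: "set_integrable lborel {s..1+s} g"
  shows "(LINT x:{s..1+s}|lborel. g x) = (LINT x:{0..1}|lborel. g x)"
proof -
  have 1: "set_integrable lborel {s..1} g" and 2: "set_integrable lborel {1..1+s} g"
    by (rule set_integrable_subset[OF int]; use s in auto)+
  have per': "(\<lambda>h. g (1 + h)) = g"
    using per by (auto simp: add.commute)
  have 3: "set_integrable lborel {0..s} g"
    using 2 set_integral_shift(1)[of 1 0 s g] by (simp add: per')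
  have "(LINT x:{s..1+s}|lborel. g x) = (LINT x:{s..1}|lborel. g x) + (LINT x:{1..1+s}|lborel. g x)"
    by (rule set_integral_combine_Icc(2)[OF _ _ 1 2]) (use s in auto)
  also have "(LINT x:{1..1+s}|lborel. g x) = (LINT x:{0..s}|lborel. g x)"
    using set_integral_shift(2)[of 1 0 s g] by (simp add: per')
  also have "(LINT x:{s..1}|lborel. g x) + (LINT x:{0..s}|lborel. g x) = (LINT x:{0..1}|lborel. g x)"
    using set_integral_combine_Icc(2)[OF _ _ 3 1] s by simp
  finally show ?thesis .
qed

lemma set_integral_periodic_translate:
  fixes g :: "real \<Rightarrow> 'a::{banach, second_countable_topology}"
  assumes cont: "continuous_on UNIV g" and per: "\<And>x. g (x + 1) = g x" and t: "0 \<le> t" "t \<le> 1"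
  shows "(LINT x:{0..1}|lborel. g (x + t)) = (LINT x:{0..1}|lborel. g x)"
    and "(LINT x:{0..1}|lborel. g (x - t)) = (LINT x:{0..1}|lborel. g x)"
proof -
  have *: "(LINT x:{0..1}|lborel. f (x + t)) = (LINT x:{0..1}|lborel. f x)"
    if "continuous_on UNIV f" "\<And>x. f (x + 1) = f x" for f :: "real \<Rightarrow> 'a"
  proof -
    have "set_integrable lborel {t..1+t} f"
      by (intro borel_integrable_atLeastAtMost' continuous_on_subset[OF that(1)]) auto
    from set_integral_periodic_shift[OF that(2) t this] show ?thesis
      using set_integral_shift(2)[of t 0 1 f] by (simp add: add.commute)
  qed
  show "(LINT x:{0..1}|lborel. g (x + t)) = (LINT x:{0..1}|lborel. g x)"
    by (rule *[OF cont per])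
  have "continuous_on UNIV (\<lambda>x. g (x - t))"
    by (rule continuous_on_compose2[OF cont]) (auto intro: continuous_on_diff continuous_on_id continuous_on_const)
  moreover have "g (x + 1 - t) = g (x - t)" for x
    using per[of "x - t"] by (simp add: algebra_simps)
  ultimately have "(LINT x:{0..1}|lborel. g (x + t - t)) = (LINT x:{0..1}|lborel. g (x - t))"
    by (rule *)
  then show "(LINT x:{0..1}|lborel. g (x - t)) = (LINT x:{0..1}|lborel. g x)"
    by simp
qed

section \<open>Differentiation under the integral sign and exchange of integrals\<close>

text \<open>Dominated convergence along sequences tending to 0: by \<open>bound\<close>,
  \<open>w\<close> majorises all difference quotients at 0, so the integrand has to be
  differentiated at 0 alone.\<close>

lemma has_real_derivative_lebesgue_integral:
  fixes f :: "real \<Rightarrow> 'a \<Rightarrow> real"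
  assumes e: "e > 0"
    and int: "\<And>\<epsilon>. \<bar>\<epsilon>\<bar> < e \<Longrightarrow> integrable M (f \<epsilon>)"
    and meas: "f' \<in> borel_measurable M"
    and w: "integrable M w"
    and bound: "\<And>\<epsilon> x. \<bar>\<epsilon>\<bar> < e \<Longrightarrow> x \<in> space M \<Longrightarrow> \<bar>f \<epsilon> x - f 0 x\<bar> \<le> \<bar>\<epsilon>\<bar> * w x"
    and deriv: "\<And>x. x \<in> space M \<Longrightarrow> ((\<lambda>\<epsilon>. f \<epsilon> x) has_real_derivative f' x) (at 0)"
  shows "((\<lambda>\<epsilon>. \<integral>x. f \<epsilon> x \<partial>M) has_real_derivative (\<integral>x. f' x \<partial>M)) (at 0)"
proof -
  \<comment> \<open>The filter is restricted so that every sequence considered stays where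
    integrability and \<open>bound\<close> are available.\<close>
  have at: "at 0 = at (0::real) within {-e<..<e}"
    using e by (subst at_within_open) auto
  have "((\<lambda>\<epsilon>. ((\<integral>x. f (0 + \<epsilon>) x \<partial>M) - (\<integral>x. f 0 x \<partial>M)) / \<epsilon>) \<longlongrightarrow> (\<integral>x. f' x \<partial>M)) (at 0 within {-e<..<e})"
    unfolding tendsto_at_iff_sequentially
  proof (intro allI impI)
    fix X :: "nat \<Rightarrow> real"
    assume X: "\<forall>i. X i \<in> {-e<..<e} - {0}" "X \<longlonglongrightarrow> 0"
    have X': "\<bar>X i\<bar> < e" "X i \<noteq> 0" for i
      using X(1)[rule_format, of i] by auto
    have "(\<lambda>i. \<integral>x. (f (X i) x - f 0 x) / X i \<partial>M) \<longlonglongrightarrow> (\<integral>x. f' x \<partial>M)"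
    proof (rule integral_dominated_convergence[where w = w])
      show "AE x in M. (\<lambda>i. (f (X i) x - f 0 x) / X i) \<longlonglongrightarrow> f' x"
      proof (intro AE_I2)
        fix x assume "x \<in> space M"
        from deriv[OF this] have "((\<lambda>h. (f (0 + h) x - f 0 x) / h) \<longlongrightarrow> f' x) (at 0)"
          by (simp add: DERIV_def)
        then show "(\<lambda>i. (f (X i) x - f 0 x) / X i) \<longlonglongrightarrow> f' x"
          unfolding tendsto_at_iff_sequentially comp_def using X X' by simp
      qed
      show "AE x in M. norm ((f (X i) x - f 0 x) / X i) \<le> w x" for i
      proof (intro AE_I2)
        fix x assume "x \<in> space M"
        from bound[OF X'(1) this, of i] X'[of i] show "norm ((f (X i) x - f 0 x) / X i) \<le> w x"
          by (simp add: divide_simps mult.commute)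
      qed
      show "(\<lambda>x. (f (X i) x - f 0 x) / X i) \<in> borel_measurable M" for i
        using int[OF X'(1), of i] int[of 0] e by (auto intro!: borel_measurable_divide borel_measurable_diff)
    qed (use meas w in auto)
    moreover have "(\<integral>x. (f (X i) x - f 0 x) / X i \<partial>M) = ((\<integral>x. f (X i) x \<partial>M) - (\<integral>x. f 0 x \<partial>M)) / X i" for i
      using int[OF X'(1), of i] int[of 0] e by simp
    ultimately show "((\<lambda>\<epsilon>. ((\<integral>x. f (0 + \<epsilon>) x \<partial>M) - (\<integral>x. f 0 x \<partial>M)) / \<epsilon>) \<circ> X) \<longlonglongrightarrow> (\<integral>x. f' x \<partial>M)"
      by (simp only: comp_def add_0_left)
  qed
  then show ?thesis
    unfolding DERIV_def at[symmetric] .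
qed

text \<open>The majorant depends on \<open>h\<close> only and \<open>A\<close> has finite measure,
  so its product with the indicator of \<open>A\<close> is integrable. This fits integrands that are
  singular at \<open>h = 0\<close> uniformly in \<open>s\<close>.\<close>

lemma integrable_pair_dominated:
  fixes g :: "real \<Rightarrow> real \<Rightarrow> 'a::{banach, second_countable_topology}"
  assumes A: "A \<in> sets borel" "emeasure lborel A < \<infinity>" and B: "B \<in> sets borel"
    and meas: "case_prod g \<in> borel_measurable (borel \<Otimes>\<^sub>M borel)"
    and w: "set_integrable lborel B w"
    and bound: "\<And>s h. s \<in> A \<Longrightarrow> h \<in> B \<Longrightarrow> norm (g s h) \<le> w h"
  shows "integrable (lborel \<Otimes>\<^sub>M lborel) (\<lambda>(s, h). indicator A s *\<^sub>R indicator B h *\<^sub>R g s h)"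
proof (rule Bochner_Integration.integrable_bound)
  have w': "(\<lambda>h. indicator B h *\<^sub>R w h) \<in> borel_measurable borel"
    using w unfolding set_integrable_def by (simp add: borel_measurable_integrable)
  have AS: "(\<lambda>s. indicator A s :: real) \<in> borel_measurable borel" and BS: "(\<lambda>s. indicator B s :: real) \<in> borel_measurable borel"
    using A B by auto
  show "integrable (lborel \<Otimes>\<^sub>M lborel) (\<lambda>(s, h). indicator A s * (indicator B h *\<^sub>R w h))"
  proof (rule lborel_pair.Fubini_integrable)
    have "integrable lborel (\<lambda>s. indicator A s * (LINT h|lborel. norm (indicator B h *\<^sub>R w h)))"
      using A by (intro integrable_mult_left integrable_real_indicator) auto
    then show "integrable lborel (\<lambda>s. LINT h|lborel. norm (case (s, h) of (s, h) \<Rightarrow> indicator A s * (indicator B h *\<^sub>R w h)))"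
      by (simp add: abs_mult)
    show "AE s in lborel. integrable lborel (\<lambda>h. case (s, h) of (s, h) \<Rightarrow> indicator A s * (indicator B h *\<^sub>R w h))"
      using w unfolding set_integrable_def by (auto intro: integrable_mult_right)
  qed (use AS w' in measurable)
  show "(\<lambda>(s, h). indicator A s *\<^sub>R indicator B h *\<^sub>R g s h) \<in> borel_measurable (lborel \<Otimes>\<^sub>M lborel)"
    using AS BS meas by measurable
  show "AE p in lborel \<Otimes>\<^sub>M lborel. norm (case p of (s, h) \<Rightarrow> indicator A s *\<^sub>R indicator B h *\<^sub>R g s h)
      \<le> norm (case p of (s, h) \<Rightarrow> indicator A s * (indicator B h *\<^sub>R w h))"
    using bound by (intro AE_I2) (auto simp: indicator_def split: prod.splits intro: order_trans[OF _ abs_ge_self])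
qed

text \<open>Both iterated integrals are compared with the integral over the product: differentiation
  in \<epsilon> takes place there, and the two equations together exchange the order.\<close>

lemma set_integral_pair:
  fixes g :: "real \<Rightarrow> real \<Rightarrow> 'a::{banach, second_countable_topology}"
  assumes "integrable (lborel \<Otimes>\<^sub>M lborel) (\<lambda>(s, h). indicator A s *\<^sub>R indicator B h *\<^sub>R g s h)"
  shows "(LINT s:A|lborel. LINT h:B|lborel. g s h)
      = (\<integral>p. (case p of (s, h) \<Rightarrow> indicator A s *\<^sub>R indicator B h *\<^sub>R g s h) \<partial>(lborel \<Otimes>\<^sub>M lborel))"
    and "(LINT h:B|lborel. LINT s:A|lborel. g s h)
      = (\<integral>p. (case p of (s, h) \<Rightarrow> indicator A s *\<^sub>R indicator B h *\<^sub>R g s h) \<partial>(lborel \<Otimes>\<^sub>M lborel))"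
proof -
  show "(LINT s:A|lborel. LINT h:B|lborel. g s h)
      = (\<integral>p. (case p of (s, h) \<Rightarrow> indicator A s *\<^sub>R indicator B h *\<^sub>R g s h) \<partial>(lborel \<Otimes>\<^sub>M lborel))"
    unfolding lborel_pair.integral_fst[OF assms, symmetric] set_lebesgue_integral_def
    by (simp del: scaleR_scaleR)
  have *: "indicator A s *\<^sub>R indicator B h *\<^sub>R g s h = indicator B h *\<^sub>R indicator A s *\<^sub>R g s h" for s h
    by simp
  have "(LINT h:B|lborel. LINT s:A|lborel. g s h) = (LINT h|lborel. LINT s|lborel. indicator A s *\<^sub>R indicator B h *\<^sub>R g s h)"
    unfolding set_lebesgue_integral_def * by (simp del: scaleR_scaleR)
  then show "(LINT h:B|lborel. LINT s:A|lborel. g s h)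
      = (\<integral>p. (case p of (s, h) \<Rightarrow> indicator A s *\<^sub>R indicator B h *\<^sub>R g s h) \<partial>(lborel \<Otimes>\<^sub>M lborel))"
    using lborel_pair.integral_snd[OF assms] by simp
qed

section \<open>The Riesz kernel\<close>

text \<open>Away from 0 this is minus the gradient of
  \<open>\<lambda>w. 1 / norm w powr \<sigma>\<close>.\<close>

definition riesz_kernel :: "real \<Rightarrow> 'a::real_inner \<Rightarrow> 'a" where
  "riesz_kernel \<sigma> w = (\<sigma> / norm w powr (2 + \<sigma>)) *\<^sub>R w"

lemma riesz_kernel_zero [simp]: "riesz_kernel \<sigma> 0 = 0"
  by (simp add: riesz_kernel_def)

lemma riesz_kernel_minus: "riesz_kernel \<sigma> (- w) = - riesz_kernel \<sigma> w"
  by (simp add: riesz_kernel_def)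

lemma continuous_on_riesz_kernel:
  assumes "continuous_on A f" "\<And>x. x \<in> A \<Longrightarrow> f x \<noteq> 0"
  shows "continuous_on A (\<lambda>x. riesz_kernel \<sigma> (f x))"
  unfolding riesz_kernel_def using assms by (intro continuous_intros) auto

lemma borel_measurable_riesz_kernel [measurable (raw)]:
  fixes f :: "'b \<Rightarrow> 'a::euclidean_space"
  assumes [measurable]: "f \<in> borel_measurable M"
  shows "(\<lambda>x. riesz_kernel \<sigma> (f x)) \<in> borel_measurable M"
  unfolding riesz_kernel_def by measurable

text \<open>Mean value inequality on \<open>{m..}\<close>: the derivative of
  \<open>x powr (- p)\<close> is largest in absolute value at the left end \<open>m\<close>.\<close>

lemma inverse_powr_lipschitz:
  fixes a b m p :: real
  assumes "m > 0" "a \<ge> m" "b \<ge> m" "p \<ge> 0"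
  shows "\<bar>1 / a powr p - 1 / b powr p\<bar> \<le> p * m powr (- p - 1) * \<bar>a - b\<bar>"
proof -
  have "norm (a powr (- p) - b powr (- p)) \<le> (p * m powr (- p - 1)) * norm (a - b)"
  proof (rule field_differentiable_bound[of "{m..}"])
    fix x assume x: "x \<in> {m..}"
    then show "((\<lambda>x. x powr (- p)) has_field_derivative (- p * x powr (- p - 1))) (at x within {m..})"
      using assms(1) by (auto intro!: derivative_eq_intros simp: powr_diff)
    have "x powr (- p - 1) \<le> m powr (- p - 1)"
      using x assms by (intro powr_mono2') auto
    then show "norm (- p * x powr (- p - 1)) \<le> p * m powr (- p - 1)"
      using assms(4) by (simp add: abs_mult mult_left_mono)
  qed (use assms in auto)
  then show ?thesis
    by (simp add: powr_minus_divide)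
qed

lemma norm_riesz_kernel_le:
  assumes "m > 0" "norm w \<ge> m" "\<sigma> \<ge> 0"
  shows "norm (riesz_kernel \<sigma> w) \<le> \<sigma> * m powr (- 1 - \<sigma>)"
proof -
  have w: "norm w > 0" using assms by linarith
  have "norm (riesz_kernel \<sigma> w) = \<sigma> * (norm w powr (- (2 + \<sigma>)) * norm w powr 1)"
    using w assms(3) powr_minus_divide[of "norm w" "2 + \<sigma>"] by (simp add: riesz_kernel_def)
  also have "\<dots> = \<sigma> * norm w powr (- 1 - \<sigma>)"
    unfolding powr_add[symmetric] by simp
  also have "\<dots> \<le> \<sigma> * m powr (- 1 - \<sigma>)"
    using assms by (intro mult_left_mono powr_mono2') auto
  finally show ?thesis .
qed

text \<open>The difference is split as in the product rule into a change of vector and a change of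
  weight; the latter multiplies \<open>b\<close>, whence the upper bound \<open>R\<close>. If
  \<open>m\<close> and \<open>R\<close> are both proportional to \<open>h\<close>, the constant
  scales like \<open>h powr (- 2 - \<sigma>)\<close>.\<close>

lemma riesz_kernel_lipschitz:
  assumes "m > 0" "norm a \<ge> m" "norm b \<ge> m" "norm b \<le> R" "\<sigma> \<ge> 0"
  shows "norm (riesz_kernel \<sigma> a - riesz_kernel \<sigma> b)
    \<le> \<sigma> * (m powr (- 2 - \<sigma>) + R * (2 + \<sigma>) * m powr (- 3 - \<sigma>)) * norm (a - b)"
proof -
  let ?q = "\<lambda>w::'a. 1 / norm w powr (2 + \<sigma>)"
  have pos: "?q a \<ge> 0" by simp
  have "?q a = norm a powr (- 2 - \<sigma>)"
    using powr_minus_divide[of "norm a" "2 + \<sigma>"] by simp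
  also have "\<dots> \<le> m powr (- 2 - \<sigma>)"
    using assms by (intro powr_mono2') auto
  finally have qa: "?q a \<le> m powr (- 2 - \<sigma>)" .
  have "\<bar>?q a - ?q b\<bar> \<le> (2 + \<sigma>) * m powr (- (2 + \<sigma>) - 1) * \<bar>norm a - norm b\<bar>"
    using assms by (intro inverse_powr_lipschitz) auto
  also have "\<dots> \<le> (2 + \<sigma>) * m powr (- (2 + \<sigma>) - 1) * norm (a - b)"
    using assms by (intro mult_left_mono norm_triangle_ineq3) auto
  finally have qab: "\<bar>?q a - ?q b\<bar> \<le> (2 + \<sigma>) * m powr (- 3 - \<sigma>) * norm (a - b)"
    by simp
  have "riesz_kernel \<sigma> a - riesz_kernel \<sigma> b = \<sigma> *\<^sub>R (?q a *\<^sub>R (a - b) + (?q a - ?q b) *\<^sub>R b)"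
    by (simp add: riesz_kernel_def algebra_simps)
  also have "norm \<dots> \<le> \<sigma> * (?q a * norm (a - b) + \<bar>?q a - ?q b\<bar> * norm b)"
    using assms(5) norm_triangle_ineq[of "?q a *\<^sub>R (a - b)" "(?q a - ?q b) *\<^sub>R b"]
    by (simp add: mult_left_mono)
  also have "\<dots> \<le> \<sigma> * (m powr (- 2 - \<sigma>) * norm (a - b) + (2 + \<sigma>) * m powr (- 3 - \<sigma>) * norm (a - b) * R)"
    using assms qa qab by (intro mult_left_mono add_mono mult_right_mono mult_mono) auto
  finally show ?thesis
    by (simp add: algebra_simps)
qed

text \<open>Chain rule through \<open>norm\<close>, whose gradient at \<open>w \<noteq> 0\<close> is
  \<open>sgn w\<close>.\<close>

lemma has_real_derivative_inverse_norm_powr: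
  fixes w u :: "'a::real_inner"
  assumes "w \<noteq> 0"
  shows "((\<lambda>\<epsilon>. 1 / norm (w + \<epsilon> *\<^sub>R u) powr \<sigma>) has_real_derivative - (riesz_kernel \<sigma> w \<bullet> u)) (at 0)"
proof -
  have "((\<lambda>\<epsilon>. norm (w + \<epsilon> *\<^sub>R u)) has_derivative (\<lambda>h. (h *\<^sub>R u) \<bullet> sgn w)) (at 0)"
    by (rule has_derivative_compose[of "\<lambda>\<epsilon>. w + \<epsilon> *\<^sub>R u" _ _ _ norm])
      (use assms in \<open>auto intro!: derivative_eq_intros has_derivative_norm\<close>)
  then have n: "((\<lambda>\<epsilon>. norm (w + \<epsilon> *\<^sub>R u)) has_real_derivative (u \<bullet> sgn w)) (at 0)"
    by (auto simp: has_field_derivative_def mult.commute elim!: has_derivative_eq_rhs)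
  have w: "norm w > 0" using assms by simp
  have "((\<lambda>\<epsilon>. norm (w + \<epsilon> *\<^sub>R u) powr (- \<sigma>)) has_real_derivative
      (- \<sigma> * norm w powr (- \<sigma> - 1)) * (u \<bullet> sgn w)) (at 0)"
    using DERIV_fun_powr[OF n, of "- \<sigma>"] w by simp
  moreover have "(- \<sigma> * norm w powr (- \<sigma> - 1)) * (u \<bullet> sgn w) = - \<sigma> * (norm w powr (- \<sigma> - 1) / norm w) * (u \<bullet> w)"
    by (simp add: sgn_div_norm field_simps)
  moreover have "norm w powr (- \<sigma> - 1) / norm w = 1 / norm w powr (2 + \<sigma>)"
    using w powr_diff[of "norm w" "- \<sigma> - 1" 1] powr_minus_divide[of "norm w" "2 + \<sigma>"] by simp
  moreover have "- \<sigma> * (1 / norm w powr (2 + \<sigma>)) * (u \<bullet> w) = - (riesz_kernel \<sigma> w \<bullet> u)"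
    by (simp add: riesz_kernel_def inner_commute)
  ultimately show ?thesis
    by (simp add: powr_minus_divide)
qed

section \<open>Periodic curves and the chord-arc bound\<close>

lemma periodic_plus_of_int:
  fixes f :: "real \<Rightarrow> 'a"
  assumes "\<And>x. f (x + 1) = f x"
  shows "f (x + of_int n) = f x"
proof -
  interpret periodic_fun_simple' f
    by unfold_locales (rule assms)
  show ?thesis by (rule plus_of_int)
qed

lemma periodic_frac:
  fixes f :: "real \<Rightarrow> 'a"
  assumes "\<And>x. f (x + 1) = f x"
  shows "f (frac x) = f x"
  using periodic_plus_of_int[of f "frac x" "\<lfloor>x\<rfloor>", OF assms] by (simp add: frac_def)

lemma periodic_bounded:
  fixes f :: "real \<Rightarrow> 'a::real_normed_vector"
  assumes cont: "continuous_on UNIV f" and per: "\<And>x. f (x + 1) = f x"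
  obtains B where "B > 0" "\<And>x. norm (f x) \<le> B"
proof -
  have "compact (f ` {0..1})"
    by (intro compact_continuous_image continuous_on_subset[OF cont]) auto
  then obtain B where B: "B > 0" "\<And>x. x \<in> {0..1} \<Longrightarrow> norm (f x) \<le> B"
    using compact_imp_bounded[of "f ` {0..1}"] by (auto simp: bounded_pos)
  have "norm (f x) \<le> B" for x
    using B(2)[of "frac x"] frac_lt_1[of x] periodic_frac[of f x, OF per] by simp
  with B(1) that show ?thesis by blast
qed

lemma continuous_on_UNIV_comp:
  fixes g :: "'b::topological_space \<Rightarrow> 'a::topological_space"
  assumes "continuous_on UNIV g" "continuous_on A f"
  shows "continuous_on A (\<lambda>x. g (f x))"
  using continuous_on_compose2[OF assms(1,2)] by simp

lemma has_vector_derivative_UNIV_continuous_on: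
  assumes "\<And>s. (f has_vector_derivative f' s) (at s)"
  shows "continuous_on UNIV f"
  by (meson assms continuous_at_imp_continuous_on has_vector_derivative_continuous)

lemma vector_derivative_bound:
  fixes f :: "real \<Rightarrow> 'a::real_normed_vector"
  assumes "\<And>s. (f has_vector_derivative f' s) (at s)" "\<And>s. norm (f' s) \<le> B"
  shows "norm (f a - f b) \<le> B * \<bar>a - b\<bar>"
proof -
  have "norm (f a - f b) \<le> B * norm (a - b)"
  proof (rule differentiable_bound[of UNIV f "\<lambda>s h. h *\<^sub>R f' s"])
    show "(f has_derivative (\<lambda>h. h *\<^sub>R f' s)) (at s within UNIV)" for s
      using assms(1) by (simp add: has_vector_derivative_def)
    show "onorm (\<lambda>h. h *\<^sub>R f' s) \<le> B" for s
      using assms(2)[of s] by (intro onorm_le) (simp add: mult.commute[of B] mult_left_mono)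
  qed auto
  then show ?thesis by simp
qed

lemma periodic_vector_derivative:
  fixes f :: "real \<Rightarrow> 'a::real_normed_vector"
  assumes f: "\<And>s. (f has_vector_derivative f' s) (at s)" and per: "\<And>s. f (s + 1) = f s"
  shows "f' (s + 1) = f' s"
proof -
  have "((\<lambda>x. x + 1) has_vector_derivative 1) (at s)"
    using has_vector_derivative_add[OF has_vector_derivative_id[of "at s"] has_vector_derivative_const[of 1 "at s"]] by simp
  from vector_diff_chain_at[OF this f] have "(f has_vector_derivative f' (s + 1)) (at s)"
    by (simp add: comp_def per)
  with f[of s] show ?thesis
    using vector_derivative_unique_at by metis
qed

text \<open>The derivatives are parameters instead of \<open>vector_derivative\<close> terms, so
  that explicit formulas can be supplied for the bump functions below.\<close>

locale periodic_C2 =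
  fixes y y' y'' :: "real \<Rightarrow> 'a::euclidean_space"
  assumes deriv: "\<And>s. (y has_vector_derivative y' s) (at s)"
    and deriv2: "\<And>s. (y' has_vector_derivative y'' s) (at s)"
    and cont2: "continuous_on UNIV y''"
    and periodic: "\<And>s. y (s + 1) = y s"
begin

lemma cont: "continuous_on UNIV y"
  by (rule has_vector_derivative_UNIV_continuous_on[OF deriv])

lemma cont1: "continuous_on UNIV y'"
  by (rule has_vector_derivative_UNIV_continuous_on[OF deriv2])

lemma measurable_curve [measurable]: "y \<in> borel_measurable borel"
  by (rule borel_measurable_continuous_onI[OF cont])

lemma periodic1: "y' (s + 1) = y' s"
  by (rule periodic_vector_derivative[OF deriv periodic])

lemma periodic2: "y'' (s + 1) = y'' s"
  by (rule periodic_vector_derivative[OF deriv2 periodic1])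

lemma lipschitz:
  obtains M where "M > 0" "\<And>a b. norm (y a - y b) \<le> M * \<bar>a - b\<bar>"
  using periodic_bounded[OF cont1 periodic1] vector_derivative_bound[OF deriv] by metis

text \<open>On the segment from \<open>s\<close> to \<open>s + h\<close> the derivative differs from
  \<open>y' s\<close> by at most \<open>K * \<bar>h\<bar>\<close>. The constant is uniform in
  \<open>s\<close> because \<open>y''\<close> is continuous and periodic, hence bounded.\<close>

lemma taylor:
  obtains K where "K > 0" "\<And>s h. norm (y (s + h) - y s - h *\<^sub>R y' s) \<le> K * h\<^sup>2"
proof -
  obtain K where K: "K > 0" "\<And>s. norm (y'' s) \<le> K"
    using periodic_bounded[OF cont2 periodic2] by metis
  have "norm (y (s + h) - y s - h *\<^sub>R y' s) \<le> K * h\<^sup>2" for s h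
  proof -
    have "norm (y (s + h) - y s - (s + h - s) *\<^sub>R y' s) \<le> norm (s + h - s) * (K * \<bar>h\<bar>)"
    proof (rule vector_differentiable_bound_linearization[where S = "closed_segment s (s + h)"])
      show "(y has_vector_derivative y' x) (at x within closed_segment s (s + h))" for x
        by (rule has_vector_derivative_at_within[OF deriv])
      fix x assume "x \<in> closed_segment s (s + h)"
      then have "\<bar>x - s\<bar> \<le> \<bar>h\<bar>"
        by (auto simp: closed_segment_eq_real_ivl split: if_splits)
      then have "K * \<bar>x - s\<bar> \<le> K * \<bar>h\<bar>"
        using K(1) by (intro mult_left_mono) auto
      then show "norm (y' x - y' s) \<le> K * \<bar>h\<bar>"
        using vector_derivative_bound[OF deriv2 K(2), of x s] by linarith
    qed auto
    then show ?thesis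
      by (simp add: power2_eq_square mult_ac flip: abs_mult)
  qed
  with K(1) that show ?thesis by blast
qed

text \<open>Short arcs are controlled by the Taylor estimate and the minimal speed, long ones by
  injectivity and compactness. The restriction \<open>h \<le> 1/2\<close> stays away from
  \<open>h = 1\<close>, where the chord closes up.\<close>

lemma chord_arc_bound:
  assumes reg: "\<And>s. y' s \<noteq> 0" and inj: "inj_on y {0..<1}"
  obtains c where "c > 0" "\<And>s h. 0 \<le> h \<Longrightarrow> h \<le> 1/2 \<Longrightarrow> c * h \<le> norm (y (s + h) - y s)"
proof -
  obtain s0 where s0: "\<And>s. s \<in> {0..1} \<Longrightarrow> norm (y' s0) \<le> norm (y' s)"
    using continuous_attains_inf[of "{0..1}" "\<lambda>s. norm (y' s)"] continuous_on_subset[OF cont1]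
    by (metis atLeastAtMost_iff compact_Icc continuous_on_norm empty_iff order_refl subset_UNIV zero_le_one)
  define m where "m = norm (y' s0)"
  have m: "m > 0" "m \<le> norm (y' s)" for s
    using reg[of s0] s0[of "frac s"] frac_lt_1[of s] periodic_frac[of y' s, OF periodic1] by (auto simp: m_def)
  obtain K where K: "K > 0" "\<And>s h. norm (y (s + h) - y s - h *\<^sub>R y' s) \<le> K * h\<^sup>2"
    using taylor by metis
  \<comment> \<open>Up to \<open>h = \<eta>\<close> the Taylor error \<open>K * h\<^sup>2\<close>
    consumes at most half of \<open>m * h\<close>.\<close>
  define \<eta> where "\<eta> = m / (2 * K)"
  have \<eta>: "\<eta> > 0" using m(1) K(1) by (simp add: \<eta>_def)
  have small: "m / 2 * h \<le> norm (y (s + h) - y s)" if "0 \<le> h" "h \<le> \<eta>" for s h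
  proof -
    have "m * h \<le> norm (h *\<^sub>R y' s)"
      using m(2)[of s] that(1) by (simp add: mult.commute mult_left_mono)
    also have "\<dots> \<le> norm (y (s + h) - y s) + norm (y (s + h) - y s - h *\<^sub>R y' s)"
      by (metis norm_triangle_sub norm_minus_commute add.commute)
    also have "norm (y (s + h) - y s - h *\<^sub>R y' s) \<le> (K * h) * h"
      using K(2)[of s h] by (simp add: power2_eq_square mult_ac)
    also have "(K * h) * h \<le> (m / 2) * h"
      using that K(1) by (intro mult_right_mono) (auto simp: \<eta>_def field_simps)
    finally show ?thesis by (simp add: field_simps)
  qed
  \<comment> \<open>Equal values force equal fractional parts, so \<open>h\<close> would be an
    integer.\<close>
  have nz: "y (s + h) \<noteq> y s" if "0 < h" "h \<le> 1/2" for s h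
  proof
    assume "y (s + h) = y s"
    then have "y (frac (s + h)) = y (frac s)"
      by (simp add: periodic_frac[of y, OF periodic])
    then have "frac (s + h) = frac s"
      by (rule inj_onD[OF inj]) (auto simp: frac_lt_1)
    then have n: "h = of_int (\<lfloor>s + h\<rfloor> - \<lfloor>s\<rfloor>)"
      by (simp add: frac_def)
    then have "0 < \<lfloor>s + h\<rfloor> - \<lfloor>s\<rfloor>" "\<lfloor>s + h\<rfloor> - \<lfloor>s\<rfloor> < 1"
      using that by linarith+
    then show False by simp
  qed
  show ?thesis
  proof (cases "\<eta> \<le> 1/2")
    case False
    with that[of "m/2"] small m(1) show ?thesis by auto
  next
    case True
    let ?Q = "{0..1::real} \<times> {\<eta>..1/2}"
    have "continuous_on ?Q (\<lambda>(s, h). norm (y (s + h) - y s))"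
      by (auto simp: case_prod_unfold intro!: continuous_intros continuous_on_UNIV_comp[OF cont])
    moreover have "compact ?Q" "?Q \<noteq> {}"
      using True by (auto intro: compact_Times)
    ultimately obtain p where p: "p \<in> ?Q" "\<And>q. q \<in> ?Q \<Longrightarrow>
        (case p of (s, h) \<Rightarrow> norm (y (s + h) - y s)) \<le> (case q of (s, h) \<Rightarrow> norm (y (s + h) - y s))"
      using continuous_attains_inf[of ?Q "\<lambda>(s, h). norm (y (s + h) - y s)"] by blast
    define \<mu> where "\<mu> = (case p of (s, h) \<Rightarrow> norm (y (s + h) - y s))"
    have \<mu>: "\<mu> > 0" using p(1) nz \<eta> by (auto simp: \<mu>_def)
    \<comment> \<open>Periodicity reduces \<open>s\<close> to \<open>frac s\<close>, where the
      minimum \<mu> over \<open>?Q\<close> applies; \<open>h \<le> 1\<close> turns this constant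
      into a linear bound.\<close>
    have large: "\<mu> * h \<le> norm (y (s + h) - y s)" if "\<eta> \<le> h" "h \<le> 1/2" for s h
    proof -
      have "y (frac s + h) = y (s + h)"
        using periodic_plus_of_int[of y "frac s + h" "\<lfloor>s\<rfloor>", OF periodic] by (simp add: frac_def)
      then have "\<mu> \<le> norm (y (s + h) - y s)"
        using p(2)[of "(frac s, h)"] that frac_lt_1[of s] periodic_frac[of y s, OF periodic]
        by (simp add: \<mu>_def less_imp_le)
      moreover have "\<mu> * h \<le> \<mu> * 1"
        using \<mu> that by (intro mult_left_mono) auto
      ultimately show ?thesis by linarith
    qed
    show ?thesis
    proof (rule that[of "min (m/2) \<mu>"])
      fix s h :: real assume h: "0 \<le> h" "h \<le> 1/2"
      have "min (m/2) \<mu> * h \<le> m/2 * h" "min (m/2) \<mu> * h \<le> \<mu> * h"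
        using h by (intro mult_right_mono; simp)+
      then show "min (m/2) \<mu> * h \<le> norm (y (s + h) - y s)"
        using small[of h s] large[of h s] h by (cases "h \<le> \<eta>") auto
    qed (use m \<mu> in auto)
  qed
qed

end

section \<open>Periodic test functions\<close>

lemma C2_periodic_imp_periodic_C2:
  fixes y :: "real \<Rightarrow> real ^ 'd"
  assumes "y \<in> C2_periodic"
  shows "periodic_C2 y (\<lambda>s. vector_derivative y (at s))
    (\<lambda>s. vector_derivative (\<lambda>t. vector_derivative y (at t)) (at s))"
proof
  show "(y has_vector_derivative vector_derivative y (at s)) (at s)" for s
    using assms by (auto simp: C2_periodic_def vector_derivative_works)
  show "((\<lambda>t. vector_derivative y (at t)) has_vector_derivative
      vector_derivative (\<lambda>t. vector_derivative y (at t)) (at s)) (at s)" for s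
    using assms by (auto simp: C2_periodic_def C1_differentiable_on_eq vector_derivative_works[symmetric])
  show "continuous_on UNIV (\<lambda>s. vector_derivative (\<lambda>t. vector_derivative y (at t)) (at s))"
    using assms by (auto simp: C2_periodic_def C1_differentiable_on_eq)
  show "y (s + 1) = y s" for s
    using assms by (auto simp: C2_periodic_def)
qed

lemma periodic_C2_imp_C2_periodic:
  fixes y :: "real \<Rightarrow> real ^ 'd"
  assumes "periodic_C2 y y' y''"
  shows "y \<in> C2_periodic"
proof -
  interpret periodic_C2 y y' y'' by fact
  have "(\<lambda>s. vector_derivative y (at s)) = y'"
    using vector_derivative_at[OF deriv] by auto
  then show ?thesis
    using deriv deriv2 cont2 periodic
    by (auto simp: C2_periodic_def C1_differentiable_on_def intro: differentiableI_vector)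
qed

section \<open>Bump functions and the fundamental lemma of the calculus of variations\<close>

text \<open>Only the kink at 0 needs care: there the difference quotient is at most
  \<open>\<bar>h\<bar> ^ n\<close>, which tends to 0 since \<open>n \<ge> 1\<close>.\<close>

lemma has_real_derivative_max_0_power:
  assumes "n \<ge> 1"
  shows "((\<lambda>x::real. max 0 x ^ Suc n) has_real_derivative real (Suc n) * max 0 x ^ n) (at x)"
proof -
  consider "x > 0" | "x < 0" | "x = 0" by linarith
  then show ?thesis
  proof cases
    case 1
    have "((\<lambda>x. x ^ Suc n) has_real_derivative real (Suc n) * max 0 x ^ n) (at x)"
      using 1 DERIV_pow[of "Suc n" x] by simp
    then show ?thesis
      by (rule has_field_derivative_transform_within_open[of _ _ _ "{0<..}"]) (use 1 in auto)
  next
    case 2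
    have "((\<lambda>x. 0) has_real_derivative real (Suc n) * max 0 x ^ n) (at x)"
      using 2 assms by (auto intro!: derivative_eq_intros)
    then show ?thesis
      by (rule has_field_derivative_transform_within_open[of _ _ _ "{..<0}"]) (use 2 in auto)
  next
    case 3
    have "((\<lambda>h::real. max 0 h ^ Suc n / h) \<longlongrightarrow> 0) (at 0)"
    proof (rule tendsto_0_le[where K = 1])
      show "((\<lambda>h. h ^ n) \<longlongrightarrow> 0) (at (0::real))"
        using assms by (auto intro!: tendsto_eq_intros)
      show "\<forall>\<^sub>F h in at (0::real). norm (max 0 h ^ Suc n / h) \<le> norm (h ^ n) * 1"
        using assms by (intro always_eventually allI) (auto simp: max_def abs_mult power_0_left)
    qed
    with 3 assms show ?thesis
      by (simp add: DERIV_def power_0_left)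
  qed
qed

text \<open>For \<open>c = cos (2 \<pi> \<eta>)\<close> the bump is supported where \<open>s\<close> is within \<open>\<eta>\<close> of \<open>s0 + \<int>\<close>.\<close>
lemma periodic_C2_bump:
  fixes a :: "'a::euclidean_space" and s0 c :: real
  defines "m \<equiv> \<lambda>s. max 0 (cos (2 * pi * (s - s0)) - c)"
  shows "periodic_C2 (\<lambda>s. m s ^ 3 *\<^sub>R a)
    (\<lambda>s. (3 * m s ^ 2 * (- sin (2 * pi * (s - s0)) * (2 * pi))) *\<^sub>R a)
    (\<lambda>s. (6 * m s * (- sin (2 * pi * (s - s0)) * (2 * pi)) ^ 2
        - 3 * m s ^ 2 * (cos (2 * pi * (s - s0)) * (2 * pi) ^ 2)) *\<^sub>R a)"
proof
  fix s :: real
  let ?u = "\<lambda>s. cos (2 * pi * (s - s0)) - c"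
  let ?u' = "\<lambda>s. - sin (2 * pi * (s - s0)) * (2 * pi)"
  have u: "(?u has_real_derivative ?u' s) (at s)"
    by (auto intro!: derivative_eq_intros)
  have u': "(?u' has_real_derivative - cos (2 * pi * (s - s0)) * (2 * pi) ^ 2) (at s)"
    by (auto intro!: derivative_eq_intros simp: power2_eq_square)
  \<comment> \<open>Starting from the cube leaves a factor \<open>m s\<close> in every term of the
    second derivative, which is therefore continuous across the edge of the support.\<close>
  have m3: "((\<lambda>s. m s ^ 3) has_real_derivative 3 * m s ^ 2 * ?u' s) (at s)"
    using DERIV_chain2[OF has_real_derivative_max_0_power[of 2 "?u s"] u]
    by (simp add: m_def eval_nat_numeral)
  have m2: "((\<lambda>s. m s ^ 2) has_real_derivative 2 * m s * ?u' s) (at s)"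
    using DERIV_chain2[OF has_real_derivative_max_0_power[of 1 "?u s"] u]
    by (simp add: m_def eval_nat_numeral)
  show "((\<lambda>s. m s ^ 3 *\<^sub>R a) has_vector_derivative (3 * m s ^ 2 * ?u' s) *\<^sub>R a) (at s)"
    using has_vector_derivative_scaleR[OF m3 has_vector_derivative_const[of a]] by simp
  have "((\<lambda>s. 3 * (m s ^ 2 * ?u' s)) has_real_derivative
      3 * (2 * m s * ?u' s * ?u' s + (- cos (2 * pi * (s - s0)) * (2 * pi) ^ 2) * m s ^ 2)) (at s)"
    by (rule DERIV_cmult[OF DERIV_mult[OF m2 u']])
  moreover have "3 * (2 * m s * ?u' s * ?u' s + (- cos (2 * pi * (s - s0)) * (2 * pi) ^ 2) * m s ^ 2)
    = 6 * m s * ?u' s ^ 2 - 3 * m s ^ 2 * (cos (2 * pi * (s - s0)) * (2 * pi) ^ 2)"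
    by (simp add: algebra_simps power2_eq_square)
  ultimately have d2: "((\<lambda>s. 3 * (m s ^ 2 * ?u' s)) has_real_derivative
      6 * m s * ?u' s ^ 2 - 3 * m s ^ 2 * (cos (2 * pi * (s - s0)) * (2 * pi) ^ 2)) (at s)"
    by metis
  show "((\<lambda>s. (3 * m s ^ 2 * ?u' s) *\<^sub>R a) has_vector_derivative
      (6 * m s * ?u' s ^ 2 - 3 * m s ^ 2 * (cos (2 * pi * (s - s0)) * (2 * pi) ^ 2)) *\<^sub>R a) (at s)"
    using has_vector_derivative_scaleR[OF d2 has_vector_derivative_const[of a]]
    by (simp add: mult.assoc)
  have "cos (2 * pi * (s + 1 - s0)) = cos (2 * pi * (s - s0) + 2 * pi)"
    by (simp add: algebra_simps)
  then show "m (s + 1) ^ 3 *\<^sub>R a = m s ^ 3 *\<^sub>R a"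
    by (simp add: m_def cos_periodic)
qed (unfold m_def, intro continuous_intros)

text \<open>If \<open>g\<close> did not vanish at a point \<open>s0\<close>, the test function
  \<open>g s0\<close> times a bump concentrated near \<open>s0\<close> would give a nonnegative
  continuous integrand, positive at \<open>s0\<close>, with integral 0.\<close>

lemma periodic_fundamental_lemma:
  fixes g :: "real \<Rightarrow> 'a::euclidean_space"
  assumes cont: "continuous_on UNIV g" and per: "\<And>s. g (s + 1) = g s"
    and orth: "\<And>z z' z''. periodic_C2 z z' z'' \<Longrightarrow> (LINT s:{0..1}|lborel. g s \<bullet> z s) = 0"
  shows "g x = 0"
proof (rule ccontr)
  \<comment> \<open>Passing to the fractional part places the point inside the interval of
    integration.\<close>
  define s0 where "s0 = frac x"
  assume "g x \<noteq> 0"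
  then have nz: "g s0 \<noteq> 0"
    by (simp add: s0_def periodic_frac[of g, OF per])
  have "isCont (\<lambda>s. g s \<bullet> g s0) s0"
    using cont by (intro continuous_intros) (simp add: continuous_on_eq_continuous_at)
  then have "\<forall>\<^sub>F s in at s0. g s \<bullet> g s0 > 0"
    using nz by (auto simp: isCont_def intro: order_tendstoD)
  then obtain d where d: "d > 0" "\<And>s. s \<noteq> s0 \<Longrightarrow> \<bar>s - s0\<bar> < d \<Longrightarrow> g s \<bullet> g s0 > 0"
    by (auto simp: eventually_at dist_real_def)
  \<comment> \<open>The cap \<open>1/4\<close> keeps \<open>2 * pi * \<eta>\<close> below
    \<open>pi\<close>, in the range where \<open>cos\<close> is decreasing.\<close>
  define \<eta> where "\<eta> = min d (1/4)"
  have \<eta>: "0 < \<eta>" "\<eta> < 1/2" and pos: "\<And>s. \<bar>s - s0\<bar> < \<eta> \<Longrightarrow> g s \<bullet> g s0 > 0"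
    using d nz by (auto simp: \<eta>_def) (metis inner_gt_zero_iff)
  define m where "m s = max 0 (cos (2 * pi * (s - s0)) - cos (2 * pi * \<eta>))" for s
  have nonneg: "0 \<le> g s \<bullet> (m s ^ 3 *\<^sub>R g s0)" for s
  proof (cases "m s = 0")
    case False
    \<comment> \<open>Subtracting the nearest integer gives the representative \<open>t\<close> of
      \<open>s\<close> within \<open>1/2\<close> of \<open>s0\<close>; there a large cosine means a
      small distance to \<open>s0\<close>.\<close>
    define n where "n = round (s - s0)"
    define t where "t = s - of_int n"
    have t: "\<bar>t - s0\<bar> \<le> 1/2"
      using of_int_round_abs_le[of "s - s0"] by (simp add: t_def n_def abs_if split: if_splits)
    have "cos (2 * pi * (s - s0)) = cos (2 * pi * (t - s0) + 2 * pi * of_int n)"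
      by (simp add: t_def algebra_simps)
    also have "\<dots> = cos (2 * pi * (t - s0))"
      by (subst cos_add) (simp add: cos_int_2pin sin_int_2pin)
    also have "\<dots> = cos (2 * pi * \<bar>t - s0\<bar>)"
      using cos_abs_real[of "2 * pi * (t - s0)"] by (simp add: abs_mult)
    finally have "cos (2 * pi * \<bar>t - s0\<bar>) > cos (2 * pi * \<eta>)"
      using False by (auto simp: m_def)
    moreover have "2 * pi * \<bar>t - s0\<bar> \<le> 2 * pi * (1/2)" "2 * pi * \<eta> \<le> 2 * pi * (1/2)"
      using t \<eta> by (intro mult_left_mono; simp)+
    ultimately have "2 * pi * \<bar>t - s0\<bar> < 2 * pi * \<eta>"
      using cos_mono_less_eq[of "2 * pi * \<eta>" "2 * pi * \<bar>t - s0\<bar>"] \<eta> by auto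
    then have "g t \<bullet> g s0 > 0"
      by (intro pos) auto
    moreover have "g s = g t"
      using periodic_plus_of_int[of g t n, OF per] by (simp add: t_def)
    ultimately show ?thesis
      by (auto simp: m_def)
  qed auto
  have contm: "continuous_on {0..1} (\<lambda>s. g s \<bullet> (m s ^ 3 *\<^sub>R g s0))"
    unfolding m_def by (intro continuous_intros continuous_on_subset[OF cont]) auto
  have "(LINT s:{0..1}|lborel. g s \<bullet> (m s ^ 3 *\<^sub>R g s0)) = 0"
    unfolding m_def by (rule orth[OF periodic_C2_bump])
  then have "integral {0..1} (\<lambda>s. g s \<bullet> (m s ^ 3 *\<^sub>R g s0)) = 0"
    using set_borel_integral_eq_integral(2)[OF borel_integrable_atLeastAtMost'[OF contm]] by simp
  then have "g s0 \<bullet> (m s0 ^ 3 *\<^sub>R g s0) = 0"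
    using integral_eq_0_iff[OF contm] nonneg frac_lt_1[of x] by (auto simp: s0_def less_imp_le)
  moreover have "cos (2 * pi * \<eta>) < cos 0"
    using \<eta> by (intro cos_monotone_0_pi) auto
  ultimately show False
    using nz by (auto simp: m_def)
qed

section \<open>The principal value\<close>

text \<open>At \<open>h = 0\<close> all terms vanish, because division by zero yields zero and \<open>0 powr (- \<sigma>) = 0\<close>.\<close>
lemma inverse_norm_powr_perturbation:
  fixes w u :: "'a::real_normed_vector"
  assumes h: "0 \<le> h" "h = 0 \<Longrightarrow> w = 0" and c: "c > 0" and \<sigma>: "\<sigma> > 0"
    and w: "c * h \<le> norm w" and u: "norm u \<le> M * h" and \<epsilon>: "\<bar>\<epsilon>\<bar> * M \<le> c / 2"
  shows "\<bar>1 / norm (w + \<epsilon> *\<^sub>R u) powr \<sigma>\<bar> \<le> (c / 2) powr (- \<sigma>) * h powr (- \<sigma>)"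
    and "\<bar>1 / norm (w + \<epsilon> *\<^sub>R u) powr \<sigma> - 1 / norm w powr \<sigma>\<bar>
      \<le> \<bar>\<epsilon>\<bar> * (\<sigma> * (c / 2) powr (- \<sigma> - 1) * M * h powr (- \<sigma>))"
proof -
  have "\<bar>1 / norm (w + \<epsilon> *\<^sub>R u) powr \<sigma>\<bar> \<le> (c / 2) powr (- \<sigma>) * h powr (- \<sigma>) \<and>
    \<bar>1 / norm (w + \<epsilon> *\<^sub>R u) powr \<sigma> - 1 / norm w powr \<sigma>\<bar>
      \<le> \<bar>\<epsilon>\<bar> * (\<sigma> * (c / 2) powr (- \<sigma> - 1) * M * h powr (- \<sigma>))"
  proof (cases "h = 0")
    case True
    with h(2) u show ?thesis by simp
  next
    case False
    with h have h: "h > 0" by simp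
    have \<epsilon>u: "\<bar>\<epsilon>\<bar> * norm u \<le> \<bar>\<epsilon>\<bar> * M * h"
      using mult_left_mono[OF u, of "\<bar>\<epsilon>\<bar>"] by (simp add: mult.assoc)
    also have "\<dots> \<le> c / 2 * h"
      using \<epsilon> h by (intro mult_right_mono) auto
    finally have half: "\<bar>\<epsilon>\<bar> * norm u \<le> c / 2 * h" .
    \<comment> \<open>The perturbation costs at most half of the chord-arc bound, so
      \<open>c / 2 * h\<close> bounds both norms from below.\<close>
    have low: "c / 2 * h \<le> norm (w + \<epsilon> *\<^sub>R u)"
      using norm_triangle_ineq4[of "w + \<epsilon> *\<^sub>R u" "\<epsilon> *\<^sub>R u"] half w by simp
    have pos: "c / 2 * h > 0" using c h by simp
    then have "norm (w + \<epsilon> *\<^sub>R u) > 0" using low by linarith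
    then have "1 / norm (w + \<epsilon> *\<^sub>R u) powr \<sigma> \<le> (c / 2 * h) powr (- \<sigma>)"
      unfolding powr_minus_divide using pos low \<sigma>
      by (intro divide_left_mono powr_mono2 mult_pos_pos) auto
    also have "(c / 2 * h) powr (- \<sigma>) = (c / 2) powr (- \<sigma>) * h powr (- \<sigma>)"
      by (rule powr_mult)
    finally have 1: "\<bar>1 / norm (w + \<epsilon> *\<^sub>R u) powr \<sigma>\<bar> \<le> (c / 2) powr (- \<sigma>) * h powr (- \<sigma>)"
      by simp
    have "\<bar>1 / norm (w + \<epsilon> *\<^sub>R u) powr \<sigma> - 1 / norm w powr \<sigma>\<bar>
        \<le> \<sigma> * (c / 2 * h) powr (- \<sigma> - 1) * \<bar>norm (w + \<epsilon> *\<^sub>R u) - norm w\<bar>"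
      using w pos low \<sigma> by (intro inverse_powr_lipschitz) auto
    also have "\<bar>norm (w + \<epsilon> *\<^sub>R u) - norm w\<bar> \<le> \<bar>\<epsilon>\<bar> * M * h"
      using norm_triangle_ineq3[of "w + \<epsilon> *\<^sub>R u" w] \<epsilon>u by simp
    finally have "\<bar>1 / norm (w + \<epsilon> *\<^sub>R u) powr \<sigma> - 1 / norm w powr \<sigma>\<bar>
        \<le> \<sigma> * (c / 2 * h) powr (- \<sigma> - 1) * (\<bar>\<epsilon>\<bar> * M * h)"
      using \<sigma> by (simp add: mult_left_mono)
    also have "(c / 2 * h) powr (- \<sigma> - 1) = (c / 2) powr (- \<sigma> - 1) * h powr (- \<sigma> - 1)"
      by (rule powr_mult)
    also have "\<sigma> * ((c / 2) powr (- \<sigma> - 1) * h powr (- \<sigma> - 1)) * (\<bar>\<epsilon>\<bar> * M * h)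
        = \<bar>\<epsilon>\<bar> * (\<sigma> * (c / 2) powr (- \<sigma> - 1) * M * (h powr (- \<sigma> - 1) * h powr 1))"
      using h by simp
    \<comment> \<open>The factor \<open>h\<close> from the increment \<open>u\<close> removes one
      order of the singularity and makes the bound integrable.\<close>
    also have "h powr (- \<sigma> - 1) * h powr 1 = h powr (- \<sigma>)"
      unfolding powr_add[symmetric] by simp
    finally show ?thesis using 1 by blast
  qed
  then show "\<bar>1 / norm (w + \<epsilon> *\<^sub>R u) powr \<sigma>\<bar> \<le> (c / 2) powr (- \<sigma>) * h powr (- \<sigma>)"
    and "\<bar>1 / norm (w + \<epsilon> *\<^sub>R u) powr \<sigma> - 1 / norm w powr \<sigma>\<bar>
      \<le> \<bar>\<epsilon>\<bar> * (\<sigma> * (c / 2) powr (- \<sigma> - 1) * M * h powr (- \<sigma>))"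
    by blast+
qed

lemma set_integrable_powr_dominated:
  fixes f :: "real \<Rightarrow> 'a::{banach, second_countable_topology}"
  assumes "\<sigma> < 1" "b \<ge> 0" and meas: "f \<in> borel_measurable borel"
    and bound: "\<And>h. 0 \<le> h \<Longrightarrow> h \<le> b \<Longrightarrow> norm (f h) \<le> C * h powr (- \<sigma>)"
  shows "set_integrable lborel {0..b} f"
proof (rule set_integrable_bound)
  show "set_integrable lborel {0..b} (\<lambda>h. C * h powr (- \<sigma>))"
    using assms(1,2) by (intro set_integrable_mult_right set_integrable_powr_lborel) auto
  show "set_borel_measurable lborel {0..b} f"
    using meas unfolding set_borel_measurable_def by measurable
  show "AE h in lborel. h \<in> {0..b} \<longrightarrow> norm (f h) \<le> norm (C * h powr (- \<sigma>))"
    using bound by (intro AE_I2) (auto intro: order_trans[OF _ abs_ge_self])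
qed

section \<open>The symmetrised kernel and the force it generates\<close>

locale chord_arc_curve = periodic_C2 y y' y'' for y y' y'' :: "real \<Rightarrow> 'a::euclidean_space" +
  fixes c \<sigma> :: real
  assumes c: "c > 0" and \<sigma>: "0 < \<sigma>" "\<sigma> < 1"
    and chord: "\<And>s h. 0 \<le> h \<Longrightarrow> h \<le> 1/2 \<Longrightarrow> c * h \<le> norm (y (s + h) - y s)"
begin

lemma chord_plus: "0 \<le> h \<Longrightarrow> h \<le> 1/2 \<Longrightarrow> c * h \<le> norm (y s - y (s + h))"
  using chord by (simp add: norm_minus_commute)

lemma chord_minus: "0 \<le> h \<Longrightarrow> h \<le> 1/2 \<Longrightarrow> c * h \<le> norm (y s - y (s - h))"
  using chord[of h "s - h"] by simp

lemma chord_nonzero: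
  assumes "0 < h" "h \<le> 1/2"
  shows "y s - y (s + h) \<noteq> 0" "y s - y (s - h) \<noteq> 0"
  using mult_pos_pos[OF c assms(1)] chord_plus[of h s] chord_minus[of h s] assms by auto

text \<open>Pairing the two points at parameter distance \<open>h\<close> from \<open>s\<close>
  builds the cancellation of the principal value into the integrand.\<close>

definition sym_kernel :: "real \<Rightarrow> real \<Rightarrow> 'a" where
  "sym_kernel s h = riesz_kernel \<sigma> (y s - y (s + h)) + riesz_kernel \<sigma> (y s - y (s - h))"

definition force :: "real \<Rightarrow> 'a" where
  "force s = (LINT h:{0..1/2}|lborel. sym_kernel s h)"

lemma measurable_sym_kernel: "case_prod sym_kernel \<in> borel_measurable (borel \<Otimes>\<^sub>M borel)"
  unfolding sym_kernel_def by measurable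

lemma measurable_sym_kernel_right: "sym_kernel s \<in> borel_measurable borel"
  unfolding sym_kernel_def by measurable

text \<open>As the kernel is odd, the sum is its difference at the forward and backward chords.
  Their linear parts in \<open>h\<close> agree, so they differ by order \<open>h\<^sup>2\<close>,
  while the Lipschitz constant of the kernel at scale \<open>h\<close> has order
  \<open>h powr (- 2 - \<sigma>)\<close>.\<close>

lemma sym_kernel_bound:
  obtains C where "C > 0" "\<And>s h. 0 \<le> h \<Longrightarrow> h \<le> 1/2 \<Longrightarrow> norm (sym_kernel s h) \<le> C * h powr (- \<sigma>)"
proof -
  obtain M where M: "M > 0" "\<And>a b. norm (y a - y b) \<le> M * \<bar>a - b\<bar>"
    using lipschitz by metis
  obtain K where K: "K > 0" "\<And>s h. norm (y (s + h) - y s - h *\<^sub>R y' s) \<le> K * h\<^sup>2"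
    using taylor by metis
  \<comment> \<open>This is the constant of \<open>riesz_kernel_lipschitz\<close> for lower bound
    \<open>c * h\<close> and upper bound \<open>M * h\<close>, stripped of powers of
    \<open>h\<close>; \<open>2 * K\<close> comes from the two Taylor errors.\<close>
  define C where "C = \<sigma> * (c powr (- 2 - \<sigma>) + M * (2 + \<sigma>) * c powr (- 3 - \<sigma>)) * (2 * K)"
  have C: "C > 0"
    unfolding C_def using c \<sigma> M(1) K(1) by (intro mult_pos_pos add_pos_nonneg) auto
  have "norm (sym_kernel s h) \<le> C * h powr (- \<sigma>)" if h: "0 \<le> h" "h \<le> 1/2" for s h
  proof (cases "h = 0")
    case True
    then show ?thesis by (simp add: sym_kernel_def)
  next
    case False
    with h have pos: "h > 0" by simp
    let ?a = "y s - y (s + h)" and ?b = "y (s - h) - y s"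
    have "?a - ?b = - ((y (s + h) - y s - h *\<^sub>R y' s) + (y (s + - h) - y s - (- h) *\<^sub>R y' s))"
      by (simp add: algebra_simps)
    also have "norm \<dots> \<le> K * h\<^sup>2 + K * (- h)\<^sup>2"
      unfolding norm_minus_cancel by (rule norm_triangle_mono[OF K(2) K(2)])
    finally have ab: "norm (?a - ?b) \<le> 2 * K * h powr 2"
      using pos by simp
    have e1: "h powr (- 2 - \<sigma>) * h powr 2 = h powr (- \<sigma>)"
      "h powr 1 * h powr (- 3 - \<sigma>) * h powr 2 = h powr (- \<sigma>)"
      unfolding powr_add[symmetric] by simp_all
    have "sym_kernel s h = riesz_kernel \<sigma> ?a - riesz_kernel \<sigma> ?b"
      unfolding sym_kernel_def using riesz_kernel_minus[of \<sigma> ?b] by simp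
    also have "norm \<dots> \<le> \<sigma> * ((c * h) powr (- 2 - \<sigma>) + (M * h) * (2 + \<sigma>) * (c * h) powr (- 3 - \<sigma>)) * norm (?a - ?b)"
      using c pos h \<sigma> chord_plus[of h s] chord[of h "s - h"] M(2)[of "s - h" s]
      by (intro riesz_kernel_lipschitz) (auto simp: norm_minus_commute)
    also have "\<dots> \<le> \<sigma> * ((c * h) powr (- 2 - \<sigma>) + (M * h) * (2 + \<sigma>) * (c * h) powr (- 3 - \<sigma>)) * (2 * K * h powr 2)"
      using ab \<sigma> M(1) pos by (intro mult_left_mono) auto
    also have "\<dots> = \<sigma> * (c powr (- 2 - \<sigma>) * (h powr (- 2 - \<sigma>) * h powr 2)
        + M * (2 + \<sigma>) * c powr (- 3 - \<sigma>) * (h powr 1 * h powr (- 3 - \<sigma>) * h powr 2)) * (2 * K)"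
      using c pos by (simp add: powr_mult algebra_simps)
    also have "\<dots> = C * h powr (- \<sigma>)"
      unfolding e1 C_def by (simp add: algebra_simps)
    finally show ?thesis .
  qed
  with C that show ?thesis by blast
qed

lemma set_integrable_sym_kernel: "set_integrable lborel {0..1/2} (sym_kernel s)"
proof -
  obtain C where "\<And>s h. 0 \<le> h \<Longrightarrow> h \<le> 1/2 \<Longrightarrow> norm (sym_kernel s h) \<le> C * h powr (- \<sigma>)"
    using sym_kernel_bound by metis
  then show ?thesis
    by (intro set_integrable_powr_dominated[OF \<sigma>(2)] measurable_sym_kernel_right) auto
qed

lemma continuous_on_kernel:
  assumes "0 < h" "h \<le> 1/2"
  shows "continuous_on UNIV (\<lambda>s. riesz_kernel \<sigma> (y s - y (s + h)))"
    and "continuous_on UNIV (\<lambda>s. riesz_kernel \<sigma> (y s - y (s - h)))"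
  using chord_nonzero[OF assms]
  by (auto intro!: continuous_on_riesz_kernel continuous_intros continuous_on_UNIV_comp[OF cont])

lemma force_periodic: "force (s + 1) = force s"
proof -
  have "sym_kernel (s + 1) h = sym_kernel s h" for h
    using periodic[of s] periodic[of "s + h"] periodic[of "s - h"]
    by (simp add: sym_kernel_def add.commute add.left_commute add_diff_eq diff_add_eq)
  then show ?thesis by (simp add: force_def)
qed

text \<open>Dominated convergence with the majorant of \<open>sym_kernel_bound\<close>, which is the
  same for all \<open>s\<close>.\<close>

lemma continuous_on_force: "continuous_on UNIV force"
proof -
  obtain C where C: "C > 0" "\<And>s h. 0 \<le> h \<Longrightarrow> h \<le> 1/2 \<Longrightarrow> norm (sym_kernel s h) \<le> C * h powr (- \<sigma>)"
    using sym_kernel_bound by metis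
  have w: "set_integrable lborel {0..1/2} (\<lambda>h. C * h powr (- \<sigma>))"
    using \<sigma>(2) by (intro set_integrable_mult_right set_integrable_powr_lborel) auto
  have "continuous (at s) force" for s
  proof (rule continuous_at_sequentiallyI)
    fix u assume u: "u \<longlonglongrightarrow> s"
    show "(\<lambda>n. force (u n)) \<longlonglongrightarrow> force s"
      unfolding force_def set_lebesgue_integral_def
    proof (rule integral_dominated_convergence[where w = "\<lambda>h. indicator {0..1/2} h *\<^sub>R (C * h powr (- \<sigma>))"])
      show "integrable lborel (\<lambda>h. indicat_real {0..1/2} h *\<^sub>R (C * h powr (- \<sigma>)))"
        using w by (simp add: set_integrable_def)
      show "AE h in lborel. (\<lambda>n. indicat_real {0..1/2} h *\<^sub>R sym_kernel (u n) h)
          \<longlonglongrightarrow> indicat_real {0..1/2} h *\<^sub>R sym_kernel s h"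
      proof (intro AE_I2)
        fix h :: real
        consider "h = 0" | "0 < h" "h \<le> 1/2" | "h \<notin> {0..1/2}" by fastforce
        then show "(\<lambda>n. indicat_real {0..1/2} h *\<^sub>R sym_kernel (u n) h)
          \<longlonglongrightarrow> indicat_real {0..1/2} h *\<^sub>R sym_kernel s h"
        proof cases
          case 2
          have "continuous_on UNIV (\<lambda>s. sym_kernel s h)"
            unfolding sym_kernel_def by (intro continuous_on_add continuous_on_kernel 2)
          then have "(\<lambda>n. sym_kernel (u n) h) \<longlonglongrightarrow> sym_kernel s h"
            by (rule continuous_on_tendsto_compose[OF _ u]) auto
          then show ?thesis by (intro tendsto_intros)
        qed (auto simp: sym_kernel_def)
      qed
      show "AE h in lborel. norm (indicat_real {0..1/2} h *\<^sub>R sym_kernel (u n) h)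
          \<le> indicat_real {0..1/2} h *\<^sub>R (C * h powr (- \<sigma>))" for n
        using C(2) by (intro AE_I2) (auto simp: indicator_def)
    qed (use measurable_sym_kernel_right in measurable)
  qed
  then show ?thesis
    by (simp add: continuous_on_eq_continuous_at)
qed

text \<open>Folding turns the truncated interval into \<open>{\<delta>..1/2}\<close>, where the
  integrand is \<open>sym_kernel\<close>. As this is integrable up to 0, the truncated integrals
  converge to the full one.\<close>

lemma principal_value:
  "((\<lambda>\<delta>. LINT r:{s + \<delta>..1 + s - \<delta>}|lborel. riesz_kernel \<sigma> (y s - y r)) \<longlongrightarrow> force s) (at_right 0)"
proof -
  have eq: "(LINT r:{s + \<delta>..1 + s - \<delta>}|lborel. riesz_kernel \<sigma> (y s - y r))
      = (LINT h:{\<delta>..1/2}|lborel. sym_kernel s h)" if "0 < \<delta>" "\<delta> < 1/2" for \<delta>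
  proof -
    have per: "y (1 + s - h) = y (s - h)" for h
      using periodic[of "s - h"] by (simp add: algebra_simps)
    have "continuous_on {\<delta>..1/2} (\<lambda>h. riesz_kernel \<sigma> (y s - y (s + h)))"
      "continuous_on {\<delta>..1/2} (\<lambda>h. riesz_kernel \<sigma> (y s - y (s - h)))"
      using chord_nonzero that
      by (auto intro!: continuous_on_riesz_kernel continuous_intros continuous_on_UNIV_comp[OF cont])
    then show ?thesis
      using that by (subst set_integral_fold_half) (auto simp: per sym_kernel_def[abs_def] intro: borel_integrable_atLeastAtMost')
  qed
  have "((\<lambda>\<delta>. LINT h:{\<delta>..1/2}|lborel. sym_kernel s h) \<longlongrightarrow> force s) (at_right 0)"
    unfolding tendsto_at_iff_sequentially comp_def
  proof (intro allI impI)
    fix X :: "nat \<Rightarrow> real"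
    assume X: "\<forall>i. X i \<in> {0<..} - {0}" "X \<longlonglongrightarrow> 0"
    show "(\<lambda>i. LINT h:{X i..1/2}|lborel. sym_kernel s h) \<longlonglongrightarrow> force s"
      unfolding force_def set_lebesgue_integral_def
    proof (rule integral_dominated_convergence[where w = "\<lambda>h. norm (indicator {0..1/2} h *\<^sub>R sym_kernel s h)"])
      show "AE h in lborel. (\<lambda>i. indicat_real {X i..1/2} h *\<^sub>R sym_kernel s h)
          \<longlonglongrightarrow> indicat_real {0..1/2} h *\<^sub>R sym_kernel s h"
      proof (intro AE_I2)
        fix h :: real
        show "(\<lambda>i. indicat_real {X i..1/2} h *\<^sub>R sym_kernel s h)
          \<longlonglongrightarrow> indicat_real {0..1/2} h *\<^sub>R sym_kernel s h"
        proof (cases "h > 0")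
          case True
          then have "\<forall>\<^sub>F i in sequentially. X i < h"
            by (rule order_tendstoD(2)[OF X(2)])
          then show ?thesis
            using True by (intro tendsto_eventually) (auto elim!: eventually_mono simp: indicator_def)
        next
          \<comment> \<open>For \<open>h < 0\<close> the indicators vanish; at \<open>h = 0\<close>
            the limit vanishes because \<open>sym_kernel s 0 = 0\<close>.\<close>
          case False
          have "indicat_real {X i..1/2} h = 0" for i
            using X(1)[rule_format, of i] False by (auto simp: indicator_def)
          moreover have "indicat_real {0..1/2} h *\<^sub>R sym_kernel s h = 0"
            using False by (cases "h = 0") (auto simp: sym_kernel_def)
          ultimately show ?thesis by (simp only: scaleR_zero_left tendsto_const)
        qed
      qed
      show "AE h in lborel. norm (indicat_real {X i..1/2} h *\<^sub>R sym_kernel s h)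
          \<le> norm (indicat_real {0..1/2} h *\<^sub>R sym_kernel s h)" for i
        using X(1)[rule_format, of i] by (intro AE_I2) (auto simp: indicator_def)
      show "integrable lborel (\<lambda>h. norm (indicat_real {0..1/2} h *\<^sub>R sym_kernel s h))"
        using set_integrable_sym_kernel[of s] unfolding set_integrable_def by (rule integrable_norm)
    qed (use measurable_sym_kernel_right in measurable)
  qed
  moreover have "\<forall>\<^sub>F \<delta> in at_right 0. (LINT h:{\<delta>..1/2}|lborel. sym_kernel s h)
      = (LINT r:{s + \<delta>..1 + s - \<delta>}|lborel. riesz_kernel \<sigma> (y s - y r))"
    unfolding eventually_at_right_field using eq by (intro exI[of _ "1/2"]) auto
  ultimately show ?thesis
    by (rule Lim_transform_eventually)
qed

end

section \<open>The first variation\<close>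

text \<open>The boundary terms at 0 and 1 cancel by periodicity.\<close>

lemma (in periodic_C2) set_integral_by_parts:
  assumes "periodic_C2 z z' z''"
  shows "(LINT s:{0..1}|lborel. y' s \<bullet> z' s) = - (LINT s:{0..1}|lborel. y'' s \<bullet> z s)"
proof -
  interpret z: periodic_C2 z z' z'' by fact
  have int: "set_integrable lborel {0..1} (\<lambda>s. y' s \<bullet> z' s)" "set_integrable lborel {0..1} (\<lambda>s. y'' s \<bullet> z s)"
    by (intro borel_integrable_atLeastAtMost' continuous_intros
        continuous_on_subset[OF cont1] continuous_on_subset[OF cont2]
        continuous_on_subset[OF z.cont] continuous_on_subset[OF z.cont1] subset_UNIV)+
  have "((\<lambda>s. y' s \<bullet> z s) has_vector_derivative (y' s \<bullet> z' s + y'' s \<bullet> z s)) (at s within {0..1})" for s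
    using bounded_bilinear.has_vector_derivative[OF bounded_bilinear_inner
        has_vector_derivative_at_within[OF deriv2] has_vector_derivative_at_within[OF z.deriv]] .
  then have "((\<lambda>s. y' s \<bullet> z' s + y'' s \<bullet> z s) has_integral (y' 1 \<bullet> z 1 - y' 0 \<bullet> z 0)) {0..1}"
    by (intro fundamental_theorem_of_calculus) auto
  moreover have "y' 1 \<bullet> z 1 = y' 0 \<bullet> z 0"
    using periodic1[of 0] z.periodic[of 0] by simp
  ultimately have "integral {0..1} (\<lambda>s. y' s \<bullet> z' s + y'' s \<bullet> z s) = 0"
    by (simp add: integral_unique)
  then have "(LINT s:{0..1}|lborel. y' s \<bullet> z' s + y'' s \<bullet> z s) = 0"
    using set_borel_integral_eq_integral(2)[OF set_integral_add(1)[OF int]] by simp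
  then show ?thesis
    using set_integral_add(2)[OF int] by simp
qed

text \<open>The integral is a quadratic polynomial in \<epsilon>, so its derivative is the
  coefficient of the linear term, which is then integrated by parts.\<close>

lemma (in periodic_C2) kinetic_derivative:
  assumes "periodic_C2 z z' z''"
  shows "((\<lambda>\<epsilon>. LINT s:{0..1}|lborel. k / 2 * (norm (y' s + \<epsilon> *\<^sub>R z' s))\<^sup>2) has_real_derivative
    - (LINT s:{0..1}|lborel. k * (y'' s \<bullet> z s))) (at 0)"
proof -
  interpret z: periodic_C2 z z' z'' by fact
  have int: "set_integrable lborel {0..1} (\<lambda>s. y' s \<bullet> y' s)" "set_integrable lborel {0..1} (\<lambda>s. y' s \<bullet> z' s)"
    "set_integrable lborel {0..1} (\<lambda>s. z' s \<bullet> z' s)"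
    by (intro borel_integrable_atLeastAtMost' continuous_intros
        continuous_on_subset[OF cont1] continuous_on_subset[OF z.cont1] subset_UNIV)+
  let ?A = "LINT s:{0..1}|lborel. y' s \<bullet> y' s" and ?B = "LINT s:{0..1}|lborel. y' s \<bullet> z' s"
    and ?C = "LINT s:{0..1}|lborel. z' s \<bullet> z' s"
  have eq: "(LINT s:{0..1}|lborel. k / 2 * (norm (y' s + \<epsilon> *\<^sub>R z' s))\<^sup>2)
      = k / 2 * (?A + 2 * \<epsilon> * ?B + \<epsilon>\<^sup>2 * ?C)" for \<epsilon>
  proof -
    have "(norm (y' s + \<epsilon> *\<^sub>R z' s))\<^sup>2 = y' s \<bullet> y' s + 2 * \<epsilon> * (y' s \<bullet> z' s) + \<epsilon>\<^sup>2 * (z' s \<bullet> z' s)" for s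
      unfolding power2_norm_eq_inner by (simp add: inner_add inner_commute power2_eq_square algebra_simps)
    then show ?thesis
      using int by (simp add: set_integral_add)
  qed
  have "((\<lambda>\<epsilon>. k / 2 * (?A + 2 * \<epsilon> * ?B + \<epsilon>\<^sup>2 * ?C)) has_real_derivative k * ?B) (at 0)"
    by (auto intro!: derivative_eq_intros)
  moreover have "k * ?B = - (LINT s:{0..1}|lborel. k * (y'' s \<bullet> z s))"
    using set_integral_by_parts[OF assms] by simp
  ultimately show ?thesis
    unfolding eq by (simp only:)
qed

section \<open>First variation of the interaction energy\<close>

context chord_arc_curve
begin

context
  fixes z z' z'' :: "real \<Rightarrow> 'a"
  assumes z: "periodic_C2 z z' z''"
begin

interpretation z: periodic_C2 z z' z'' by (rule z)

text \<open>The perturbed interaction integrand after a period in \<open>r\<close> has been folded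
  onto \<open>{0..1/2}\<close>.\<close>

definition energy_density :: "real \<Rightarrow> real \<Rightarrow> real \<Rightarrow> real" where
  "energy_density \<epsilon> s h = 1 / norm ((y s - y (s + h)) + \<epsilon> *\<^sub>R (z s - z (s + h))) powr \<sigma>
     + 1 / norm ((y s - y (s - h)) + \<epsilon> *\<^sub>R (z s - z (s - h))) powr \<sigma>"

text \<open>For \<open>0 < h \<le> 1/2\<close> this is the derivative of
  \<open>energy_density\<close> in \<epsilon> at 0; at \<open>h = 0\<close> both are 0.\<close>

definition variation_density :: "real \<Rightarrow> real \<Rightarrow> real" where
  "variation_density s h = - (riesz_kernel \<sigma> (y s - y (s + h)) \<bullet> (z s - z (s + h)))
     - riesz_kernel \<sigma> (y s - y (s - h)) \<bullet> (z s - z (s - h))"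

lemma measurable_energy_density: "case_prod (energy_density \<epsilon>) \<in> borel_measurable (borel \<Otimes>\<^sub>M borel)"
  unfolding energy_density_def by measurable

lemma measurable_variation_density: "case_prod variation_density \<in> borel_measurable (borel \<Otimes>\<^sub>M borel)"
  unfolding variation_density_def by measurable

text \<open>One pair \<open>e\<close>, \<open>C\<close> serves all estimates. The two summands of
  \<open>energy_density\<close> are bounded separately because folding needs each half to be
  integrable.\<close>

lemma perturbation_bounds:
  obtains e C where "e > 0" "C > 0"
    and "\<And>\<epsilon> s h. \<bar>\<epsilon>\<bar> < e \<Longrightarrow> 0 \<le> h \<Longrightarrow> h \<le> 1/2 \<Longrightarrow>
      \<bar>1 / norm ((y s - y (s + h)) + \<epsilon> *\<^sub>R (z s - z (s + h))) powr \<sigma>\<bar> \<le> C * h powr (- \<sigma>)"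
    and "\<And>\<epsilon> s h. \<bar>\<epsilon>\<bar> < e \<Longrightarrow> 0 \<le> h \<Longrightarrow> h \<le> 1/2 \<Longrightarrow>
      \<bar>1 / norm ((y s - y (s - h)) + \<epsilon> *\<^sub>R (z s - z (s - h))) powr \<sigma>\<bar> \<le> C * h powr (- \<sigma>)"
    and "\<And>\<epsilon> s h. \<bar>\<epsilon>\<bar> < e \<Longrightarrow> 0 \<le> h \<Longrightarrow> h \<le> 1/2 \<Longrightarrow>
      \<bar>energy_density \<epsilon> s h - energy_density 0 s h\<bar> \<le> \<bar>\<epsilon>\<bar> * (C * h powr (- \<sigma>))"
    and "\<And>s h. 0 \<le> h \<Longrightarrow> h \<le> 1/2 \<Longrightarrow> \<bar>variation_density s h\<bar> \<le> C * h powr (- \<sigma>)"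
proof -
  obtain M where M: "M > 0" "\<And>a b. norm (z a - z b) \<le> M * \<bar>a - b\<bar>"
    using z.lipschitz by metis
  \<comment> \<open>Below this size the perturbation changes a chord by at most half of its lower
    bound \<open>c * h\<close>.\<close>
  define e where "e = c / (2 * M)"
  define C1 where "C1 = (c / 2) powr (- \<sigma>)"
  define C2 where "C2 = \<sigma> * (c / 2) powr (- \<sigma> - 1) * M"
  define C3 where "C3 = \<sigma> * c powr (- 1 - \<sigma>) * M"
  define C where "C = C1 + 2 * C2 + 2 * C3"
  have Ci: "C1 > 0" "C2 > 0" "C3 > 0"
    using c \<sigma> M(1) by (auto simp: C1_def C2_def C3_def)
  have e: "e > 0" using c M(1) by (simp add: e_def)
  have small: "\<bar>\<epsilon>\<bar> * M \<le> c / 2" if "\<bar>\<epsilon>\<bar> < e" for \<epsilon>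
    using that M(1) by (simp add: e_def field_simps)
  have zp: "norm (z s - z (s + h)) \<le> M * h" "norm (z s - z (s - h)) \<le> M * h" if "0 \<le> h" for s h
    using M(2)[of s "s + h"] M(2)[of s "s - h"] that by auto
  have up: "K * h powr (- \<sigma>) \<le> C * h powr (- \<sigma>)" if "K \<le> C" for K h :: real
    using that by (intro mult_right_mono) auto
  note pert_p = inverse_norm_powr_perturbation[OF _ _ c \<sigma>(1) chord_plus zp(1) small]
  note pert_m = inverse_norm_powr_perturbation[OF _ _ c \<sigma>(1) chord_minus zp(2) small]
  show ?thesis
  proof (rule that[OF e])
    show "C > 0" using Ci by (simp add: C_def)
    fix \<epsilon> s h :: real
    assume h: "0 \<le> h" "h \<le> 1/2"
    {
      assume \<epsilon>: "\<bar>\<epsilon>\<bar> < e"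
      have "C1 \<le> C" using Ci by (simp add: C_def)
      from up[OF this, of h] pert_p(1)[OF _ _ h h(1) \<epsilon>, of s] pert_m(1)[OF _ _ h h(1) \<epsilon>, of s] h
      show "\<bar>1 / norm ((y s - y (s + h)) + \<epsilon> *\<^sub>R (z s - z (s + h))) powr \<sigma>\<bar> \<le> C * h powr (- \<sigma>)"
        and "\<bar>1 / norm ((y s - y (s - h)) + \<epsilon> *\<^sub>R (z s - z (s - h))) powr \<sigma>\<bar> \<le> C * h powr (- \<sigma>)"
        unfolding C1_def by (smt (verit, best) add_0_right diff_self diff_zero)+
      have "\<bar>energy_density \<epsilon> s h - energy_density 0 s h\<bar> \<le> \<bar>\<epsilon>\<bar> * (C2 * h powr (- \<sigma>)) + \<bar>\<epsilon>\<bar> * (C2 * h powr (- \<sigma>))"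
        using pert_p(2)[OF _ _ h h(1) \<epsilon>, of s] pert_m(2)[OF _ _ h h(1) \<epsilon>, of s] h
        unfolding C2_def energy_density_def by (smt (verit, best) add_0_right diff_self diff_zero scaleR_zero_left)
      also have "\<dots> = \<bar>\<epsilon>\<bar> * (2 * C2 * h powr (- \<sigma>))"
        by simp
      also have "\<dots> \<le> \<bar>\<epsilon>\<bar> * (C * h powr (- \<sigma>))"
        using Ci by (intro mult_left_mono up) (auto simp: C_def)
      finally show "\<bar>energy_density \<epsilon> s h - energy_density 0 s h\<bar> \<le> \<bar>\<epsilon>\<bar> * (C * h powr (- \<sigma>))" .
    }
    show "\<bar>variation_density s h\<bar> \<le> C * h powr (- \<sigma>)"
    proof (cases "h = 0")
      case True
      then show ?thesis by (simp add: variation_density_def)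
    next
      case False
      with h have pos: "h > 0" by simp
      have *: "\<bar>riesz_kernel \<sigma> w \<bullet> u\<bar> \<le> C3 * h powr (- \<sigma>)"
        if "c * h \<le> norm w" "norm u \<le> M * h" for w u :: 'a
      proof -
        have "\<bar>riesz_kernel \<sigma> w \<bullet> u\<bar> \<le> norm (riesz_kernel \<sigma> w) * norm u"
          by (rule Cauchy_Schwarz_ineq2)
        also have "\<dots> \<le> (\<sigma> * (c * h) powr (- 1 - \<sigma>)) * (M * h)"
          using that c pos \<sigma> by (intro mult_mono norm_riesz_kernel_le) auto
        also have "\<dots> = C3 * (h powr (- 1 - \<sigma>) * h powr 1)"
          using c pos by (simp add: C3_def powr_mult)
        also have "h powr (- 1 - \<sigma>) * h powr 1 = h powr (- \<sigma>)"
          unfolding powr_add[symmetric] by simp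
        finally show ?thesis .
      qed
      have "\<bar>variation_density s h\<bar> \<le> C3 * h powr (- \<sigma>) + C3 * h powr (- \<sigma>)"
        using *[OF chord_plus[OF h] zp(1)[OF h(1)], of s s] *[OF chord_minus[OF h] zp(2)[OF h(1)], of s s]
        unfolding variation_density_def by linarith
      also have "\<dots> = 2 * C3 * h powr (- \<sigma>)"
        by simp
      also have "\<dots> \<le> C * h powr (- \<sigma>)"
        using Ci by (intro up) (auto simp: C_def)
      finally show ?thesis .
    qed
  qed
qed


text \<open>The period \<open>{0..1}\<close> is first moved to \<open>{s..1 + s}\<close>, which puts
  the singularity at the two end points, and then folded at its midpoint.\<close>

lemma inner_integral_eq_energy_density:
  assumes e: "\<And>s h. 0 \<le> h \<Longrightarrow> h \<le> 1/2 \<Longrightarrow>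
      \<bar>1 / norm ((y s - y (s + h)) + \<epsilon> *\<^sub>R (z s - z (s + h))) powr \<sigma>\<bar> \<le> C * h powr (- \<sigma>)"
      "\<And>s h. 0 \<le> h \<Longrightarrow> h \<le> 1/2 \<Longrightarrow>
      \<bar>1 / norm ((y s - y (s - h)) + \<epsilon> *\<^sub>R (z s - z (s - h))) powr \<sigma>\<bar> \<le> C * h powr (- \<sigma>)"
    and s: "s \<in> {0..1}"
  shows "(LINT r:{0..1}|lborel. 1 / norm ((y s + \<epsilon> *\<^sub>R z s) - (y r + \<epsilon> *\<^sub>R z r)) powr \<sigma>)
    = (LINT h:{0..1/2}|lborel. energy_density \<epsilon> s h)"
proof -
  let ?g = "\<lambda>r. 1 / norm ((y s + \<epsilon> *\<^sub>R z s) - (y r + \<epsilon> *\<^sub>R z r)) powr \<sigma>"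
  have diff: "(y s + \<epsilon> *\<^sub>R z s) - (y r + \<epsilon> *\<^sub>R z r) = (y s - y r) + \<epsilon> *\<^sub>R (z s - z r)" for r
    by (simp add: algebra_simps)
  have per: "?g (r + 1) = ?g r" for r
    by (simp add: periodic z.periodic)
  have refl: "?g (1 + s - h) = ?g (s - h)" for h
    using per[of "s - h"] by (simp add: algebra_simps)
  have p: "set_integrable lborel {0..1/2} (\<lambda>h. ?g (s + h))"
    unfolding diff by (rule set_integrable_powr_dominated[OF \<sigma>(2)]) (use e(1) in auto)
  have m: "set_integrable lborel {0..1/2} (\<lambda>h. ?g (1 + s - h))"
    unfolding refl unfolding diff by (rule set_integrable_powr_dominated[OF \<sigma>(2)]) (use e(2) in auto)
  have "set_integrable lborel {s + 0..1 + s - 0} ?g"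
    by (rule set_integral_fold_half(1)[OF _ p m]) simp
  then have "(LINT r:{0..1}|lborel. ?g r) = (LINT r:{s..1 + s}|lborel. ?g r)"
    using set_integral_periodic_shift[of ?g s] per s by simp
  also have "\<dots> = (LINT h:{0..1/2}|lborel. ?g (s + h) + ?g (1 + s - h))"
    using set_integral_fold_half(2)[OF _ p m] by simp
  also have "\<dots> = (LINT h:{0..1/2}|lborel. energy_density \<epsilon> s h)"
    unfolding refl unfolding diff energy_density_def ..
  finally show ?thesis .
qed

text \<open>The derivative is taken in the integral of \<open>energy_density\<close> over the
  product, where \<open>C * h powr (- \<sigma>)\<close> dominates the difference quotients; the
  iterated integrals are recovered afterwards.\<close>

lemma interaction_derivative_aux:
  "((\<lambda>\<epsilon>. LINT s:{0..1}|lborel. LINT r:{0..1}|lborel. 1 / norm ((y s + \<epsilon> *\<^sub>R z s) - (y r + \<epsilon> *\<^sub>R z r)) powr \<sigma>)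
    has_real_derivative (LINT s:{0..1}|lborel. LINT h:{0..1/2}|lborel. variation_density s h)) (at 0)"
proof -
  obtain e C where e: "e > 0" "C > 0"
    and bp: "\<And>\<epsilon> s h. \<bar>\<epsilon>\<bar> < e \<Longrightarrow> 0 \<le> h \<Longrightarrow> h \<le> 1/2 \<Longrightarrow>
      \<bar>1 / norm ((y s - y (s + h)) + \<epsilon> *\<^sub>R (z s - z (s + h))) powr \<sigma>\<bar> \<le> C * h powr (- \<sigma>)"
    and bm: "\<And>\<epsilon> s h. \<bar>\<epsilon>\<bar> < e \<Longrightarrow> 0 \<le> h \<Longrightarrow> h \<le> 1/2 \<Longrightarrow>
      \<bar>1 / norm ((y s - y (s - h)) + \<epsilon> *\<^sub>R (z s - z (s - h))) powr \<sigma>\<bar> \<le> C * h powr (- \<sigma>)"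
    and be: "\<And>\<epsilon> s h. \<bar>\<epsilon>\<bar> < e \<Longrightarrow> 0 \<le> h \<Longrightarrow> h \<le> 1/2 \<Longrightarrow>
      \<bar>energy_density \<epsilon> s h - energy_density 0 s h\<bar> \<le> \<bar>\<epsilon>\<bar> * (C * h powr (- \<sigma>))"
    and bv: "\<And>s h. 0 \<le> h \<Longrightarrow> h \<le> 1/2 \<Longrightarrow> \<bar>variation_density s h\<bar> \<le> C * h powr (- \<sigma>)"
    using perturbation_bounds by blast
  let ?ind = "\<lambda>(g :: real \<Rightarrow> real \<Rightarrow> real) (s, h). indicator {0..1} s *\<^sub>R indicator {0..1/2} h *\<^sub>R g s h"
  have w: "set_integrable lborel {0..1/2} (\<lambda>h. K * h powr (- \<sigma>))" for K
    using \<sigma>(2) by (intro set_integrable_mult_right set_integrable_powr_lborel) auto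
  have wI: "integrable (lborel \<Otimes>\<^sub>M lborel) (?ind (\<lambda>s h. C * h powr (- \<sigma>)))"
    by (rule integrable_pair_dominated[OF _ _ _ _ w[of C]]) (use e in \<open>auto simp: abs_mult\<close>)
  have eI: "integrable (lborel \<Otimes>\<^sub>M lborel) (?ind (energy_density \<epsilon>))" if "\<bar>\<epsilon>\<bar> < e" for \<epsilon>
  proof (rule integrable_pair_dominated[OF _ _ _ measurable_energy_density w[of "2 * C"]])
    fix s h :: real assume "h \<in> {0..1/2}"
    then show "norm (energy_density \<epsilon> s h) \<le> 2 * C * h powr (- \<sigma>)"
      using bp[OF that, of h s] bm[OF that, of h s] unfolding energy_density_def by simp
  qed auto
  have vI: "integrable (lborel \<Otimes>\<^sub>M lborel) (?ind variation_density)"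
    by (rule integrable_pair_dominated[OF _ _ _ measurable_variation_density w[of C]]) (use bv in auto)
  have "((\<lambda>\<epsilon>. \<integral>p. ?ind (energy_density \<epsilon>) p \<partial>(lborel \<Otimes>\<^sub>M lborel)) has_real_derivative
      (\<integral>p. ?ind variation_density p \<partial>(lborel \<Otimes>\<^sub>M lborel))) (at 0)"
  proof (rule has_real_derivative_lebesgue_integral[OF e(1) eI _ wI])
    show "?ind variation_density \<in> borel_measurable (lborel \<Otimes>\<^sub>M lborel)"
      by (rule borel_measurable_integrable[OF vI])
    show "\<bar>?ind (energy_density \<epsilon>) p - ?ind (energy_density 0) p\<bar> \<le> \<bar>\<epsilon>\<bar> * ?ind (\<lambda>s h. C * h powr (- \<sigma>)) p"
      if "\<bar>\<epsilon>\<bar> < e" for \<epsilon> p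
      using be[OF that, of "snd p" "fst p"] by (auto simp: indicator_def split: prod.splits)
    show "((\<lambda>\<epsilon>. ?ind (energy_density \<epsilon>) p) has_real_derivative ?ind variation_density p) (at 0)" for p
    proof (cases p)
      case (Pair s h)
      \<comment> \<open>In the first two cases the integrand is 0 for every \<epsilon>; in the third
        the chords are nonzero and the chain rule applies.\<close>
      consider "h = 0" | "h \<notin> {0..1/2}" | "0 < h" "h \<le> 1/2" by fastforce
      then show ?thesis
      proof cases
        case 3
        have "((\<lambda>\<epsilon>. energy_density \<epsilon> s h) has_real_derivative variation_density s h) (at 0)"
          unfolding energy_density_def variation_density_def
          using DERIV_add[OF has_real_derivative_inverse_norm_powr[OF chord_nonzero(1)[OF 3]]
              has_real_derivative_inverse_norm_powr[OF chord_nonzero(2)[OF 3]]] by simp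
        then show ?thesis
          using Pair by (auto simp: indicator_def)
      qed (use Pair in \<open>auto simp: energy_density_def variation_density_def\<close>)
    qed
  qed auto
  then have deriv: "((\<lambda>\<epsilon>. \<integral>p. ?ind (energy_density \<epsilon>) p \<partial>(lborel \<Otimes>\<^sub>M lborel)) has_real_derivative
      (LINT s:{0..1}|lborel. LINT h:{0..1/2}|lborel. variation_density s h)) (at 0)"
    unfolding set_integral_pair(1)[OF vI] .
  show ?thesis
  \<comment> \<open>Product and iterated integrals are identified only for small \<epsilon>, which
    suffices for the derivative at 0.\<close>
  proof (rule has_field_derivative_transform_within_open[OF deriv, of "{-e<..<e}"])
    fix \<epsilon> assume "\<epsilon> \<in> {-e<..<e}"
    then have \<epsilon>: "\<bar>\<epsilon>\<bar> < e" by auto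
    have "(LINT s:{0..1}|lborel. LINT h:{0..1/2}|lborel. energy_density \<epsilon> s h)
        = (LINT s:{0..1}|lborel. LINT r:{0..1}|lborel. 1 / norm ((y s + \<epsilon> *\<^sub>R z s) - (y r + \<epsilon> *\<^sub>R z r)) powr \<sigma>)"
      by (rule set_lebesgue_integral_cong)
        (auto intro!: inner_integral_eq_energy_density[OF bp[OF \<epsilon>] bm[OF \<epsilon>], symmetric])
    then show "(\<integral>p. ?ind (energy_density \<epsilon>) p \<partial>(lborel \<Otimes>\<^sub>M lborel))
        = (LINT s:{0..1}|lborel. LINT r:{0..1}|lborel. 1 / norm ((y s + \<epsilon> *\<^sub>R z s) - (y r + \<epsilon> *\<^sub>R z r)) powr \<sigma>)"
      unfolding set_integral_pair(1)[OF eI[OF \<epsilon>]] .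
  qed (use e in auto)
qed

text \<open>
  For fixed \<open>h\<close> everything is continuous in \<open>s\<close>, and translation by \<open>h\<close> exchanges the two
  halves of the symmetrised kernel up to sign, since the kernel is odd.
\<close>
lemma variation_slice:
  assumes h: "0 \<le> h" "h \<le> 1/2"
  shows "(LINT s:{0..1}|lborel. variation_density s h) = (LINT s:{0..1}|lborel. - 2 * (sym_kernel s h \<bullet> z s))"
proof (cases "h = 0")
  case True
  then show ?thesis by (simp add: variation_density_def sym_kernel_def)
next
  case False
  with h have pos: "0 < h" by simp
  define P where "P s = riesz_kernel \<sigma> (y s - y (s + h))" for s
  define Q where "Q s = riesz_kernel \<sigma> (y s - y (s - h))" for s
  have contP: "continuous_on UNIV P" and contQ: "continuous_on UNIV Q"
    unfolding P_def Q_def using continuous_on_kernel[OF pos h(2)] by auto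
  have QP: "Q (s + h) = - P s" "P (s - h) = - Q s" for s
    using riesz_kernel_minus[of \<sigma> "y s - y (s + h)"] riesz_kernel_minus[of \<sigma> "y s - y (s - h)"]
    by (simp_all add: P_def Q_def)
  have perP: "P (s + 1) = P s" and perQ: "Q (s + 1) = Q s" for s
    using periodic[of s] periodic[of "s + h"] periodic[of "s - h"]
    by (simp_all add: P_def Q_def algebra_simps)
  have contz: "continuous_on UNIV (\<lambda>s. P s \<bullet> z s)" "continuous_on UNIV (\<lambda>s. Q s \<bullet> z s)"
    by (intro continuous_on_inner contP contQ z.cont)+
  have contz': "continuous_on UNIV (\<lambda>s. P s \<bullet> z (s + h))" "continuous_on UNIV (\<lambda>s. Q s \<bullet> z (s - h))"
    by (intro continuous_on_inner contP contQ continuous_on_UNIV_comp[OF z.cont] continuous_intros)+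
  have int: "set_integrable lborel {0..1} f" if "continuous_on UNIV f" for f :: "real \<Rightarrow> real"
    by (intro borel_integrable_atLeastAtMost' continuous_on_subset[OF that] subset_UNIV)
  note [simp] = set_integral_add set_integral_diff int[OF contz(1)] int[OF contz(2)] int[OF contz'(1)] int[OF contz'(2)]
  have "(LINT s:{0..1}|lborel. Q (s + h) \<bullet> z (s + h)) = (LINT s:{0..1}|lborel. Q s \<bullet> z s)"
    by (rule set_integral_periodic_translate(1)[OF contz(2)]) (use h in \<open>auto simp: perQ z.periodic\<close>)
  then have 1: "(LINT s:{0..1}|lborel. P s \<bullet> z (s + h)) = - (LINT s:{0..1}|lborel. Q s \<bullet> z s)"
    by (simp add: QP set_integral_uminus)
  have "(LINT s:{0..1}|lborel. P (s - h) \<bullet> z (s - h)) = (LINT s:{0..1}|lborel. P s \<bullet> z s)"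
    by (rule set_integral_periodic_translate(2)[OF contz(1)]) (use h in \<open>auto simp: perP z.periodic\<close>)
  then have 2: "(LINT s:{0..1}|lborel. Q s \<bullet> z (s - h)) = - (LINT s:{0..1}|lborel. P s \<bullet> z s)"
    by (simp add: QP set_integral_uminus)
  have "(LINT s:{0..1}|lborel. variation_density s h)
      = (LINT s:{0..1}|lborel. ((P s \<bullet> z (s + h)) + (Q s \<bullet> z (s - h))) - ((P s \<bullet> z s) + (Q s \<bullet> z s)))"
    by (simp add: variation_density_def P_def Q_def inner_diff_right algebra_simps)
  \<comment> \<open>The translated terms reproduce the negative of the untranslated sum; hence the
    factor 2.\<close>
  also have "\<dots> = - 2 * (LINT s:{0..1}|lborel. (P s \<bullet> z s) + (Q s \<bullet> z s))"
    using 1 2 by simp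
  also have "\<dots> = (LINT s:{0..1}|lborel. - 2 * ((P s \<bullet> z s) + (Q s \<bullet> z s)))"
    by (rule set_integral_mult_right[symmetric])
  also have "\<dots> = (LINT s:{0..1}|lborel. - 2 * (sym_kernel s h \<bullet> z s))"
    by (simp only: sym_kernel_def P_def Q_def inner_add_left)
  finally show ?thesis .
qed

text \<open>The \<open>s\<close>-integral is brought inside so that \<open>variation_slice\<close>
  can translate in \<open>s\<close> at fixed \<open>h\<close>, and the order is then restored. Each
  half of the kernel has order \<open>- 1 - \<sigma>\<close> in \<open>h\<close>; the return is
  possible because the slice leaves them combined in \<open>sym_kernel\<close>.\<close>

lemma integral_variation_density:
  "(LINT s:{0..1}|lborel. LINT h:{0..1/2}|lborel. variation_density s h)
    = - 2 * (LINT s:{0..1}|lborel. force s \<bullet> z s)"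
proof -
  obtain C where bv: "\<And>s h. 0 \<le> h \<Longrightarrow> h \<le> 1/2 \<Longrightarrow> \<bar>variation_density s h\<bar> \<le> C * h powr (- \<sigma>)"
    using perturbation_bounds by metis
  obtain K where K: "K > 0" "\<And>s h. 0 \<le> h \<Longrightarrow> h \<le> 1/2 \<Longrightarrow> norm (sym_kernel s h) \<le> K * h powr (- \<sigma>)"
    using sym_kernel_bound by metis
  obtain B where B: "B > 0" "\<And>s. norm (z s) \<le> B"
    using periodic_bounded[OF z.cont z.periodic] by metis
  have w: "set_integrable lborel {0..1/2} (\<lambda>h. K * h powr (- \<sigma>))" for K
    using \<sigma>(2) by (intro set_integrable_mult_right set_integrable_powr_lborel) auto
  have vI: "integrable (lborel \<Otimes>\<^sub>M lborel) (\<lambda>(s, h). indicator {0..1} s *\<^sub>R indicator {0..1/2} h *\<^sub>R variation_density s h)"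
    by (rule integrable_pair_dominated[OF _ _ _ measurable_variation_density w[of C]]) (use bv in auto)
  have kI: "integrable (lborel \<Otimes>\<^sub>M lborel)
      (\<lambda>(s, h). indicator {0..1} s *\<^sub>R indicator {0..1/2} h *\<^sub>R (- 2 * (sym_kernel s h \<bullet> z s)))"
  proof (rule integrable_pair_dominated[OF _ _ _ _ w[of "2 * K * B"]])
    show "(\<lambda>(s, h). - 2 * (sym_kernel s h \<bullet> z s)) \<in> borel_measurable (borel \<Otimes>\<^sub>M borel)"
      using measurable_sym_kernel by measurable
    fix s h :: real assume "h \<in> {0..1/2}"
    then have "norm (sym_kernel s h) * norm (z s) \<le> (K * h powr (- \<sigma>)) * B"
      using K B by (intro mult_mono) auto
    then show "norm (- 2 * (sym_kernel s h \<bullet> z s)) \<le> 2 * K * B * h powr (- \<sigma>)"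
      using Cauchy_Schwarz_ineq2[of "sym_kernel s h" "z s"] by (simp add: abs_mult mult_ac)
  qed auto
  have "(LINT s:{0..1}|lborel. LINT h:{0..1/2}|lborel. variation_density s h)
      = (LINT h:{0..1/2}|lborel. LINT s:{0..1}|lborel. variation_density s h)"
    unfolding set_integral_pair[OF vI] ..
  also have "\<dots> = (LINT h:{0..1/2}|lborel. LINT s:{0..1}|lborel. - 2 * (sym_kernel s h \<bullet> z s))"
    by (rule set_lebesgue_integral_cong) (use variation_slice in auto)
  also have "\<dots> = (LINT s:{0..1}|lborel. LINT h:{0..1/2}|lborel. - 2 * (sym_kernel s h \<bullet> z s))"
    unfolding set_integral_pair[OF kI] ..
  also have "\<dots> = (LINT s:{0..1}|lborel. - 2 * (force s \<bullet> z s))"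
  proof -
    have "(LINT h:{0..1/2}|lborel. sym_kernel s h \<bullet> z s) = force s \<bullet> z s" for s
      using integral_inner_left[of "z s" lborel "\<lambda>h. indicator {0..1/2} h *\<^sub>R sym_kernel s h"]
        set_integrable_sym_kernel[of s]
      unfolding force_def set_lebesgue_integral_def set_integrable_def by simp
    then show ?thesis by (simp only: set_integral_mult_right)
  qed
  also have "\<dots> = - 2 * (LINT s:{0..1}|lborel. force s \<bullet> z s)"
    by (rule set_integral_mult_right)
  finally show ?thesis .
qed

lemma interaction_derivative:
  "((\<lambda>\<epsilon>. LINT s:{0..1}|lborel. LINT r:{0..1}|lborel. 1 / norm ((y s + \<epsilon> *\<^sub>R z s) - (y r + \<epsilon> *\<^sub>R z r)) powr \<sigma>)
    has_real_derivative - 2 * (LINT s:{0..1}|lborel. force s \<bullet> z s)) (at 0)"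
  using interaction_derivative_aux unfolding integral_variation_density .

end

end

section \<open>The Euler-Lagrange equation\<close>

text \<open>The kinetic and interaction variations add up; the factor \<open>1 / 2\<close> in
  \<open>action\<close> meets the \<open>- 2\<close> of
  \<open>interaction_derivative\<close>.\<close>

lemma action_derivative:
  fixes y z :: "real \<Rightarrow> real ^ 'd"
  assumes curve: "chord_arc_curve y y' y'' c \<sigma>" and z: "periodic_C2 z z' z''"
  shows "((\<lambda>\<epsilon>. action v \<sigma> (\<lambda>s. y s + \<epsilon> *\<^sub>R z s)) has_real_derivative
    - (LINT s:{0..1}|lborel. (v\<^sup>2 *\<^sub>R y'' s + chord_arc_curve.force y \<sigma> s) \<bullet> z s)) (at 0)"
proof -
  interpret chord_arc_curve y y' y'' c \<sigma> by (rule curve)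
  interpret z: periodic_C2 z z' z'' by (rule z)
  have vd: "vector_derivative (\<lambda>s. y s + \<epsilon> *\<^sub>R z s) (at s) = y' s + \<epsilon> *\<^sub>R z' s" for \<epsilon> s
    by (rule vector_derivative_at)
      (rule has_vector_derivative_add[OF deriv bounded_linear.has_vector_derivative[OF bounded_linear_scaleR_right z.deriv]])
  have "((\<lambda>\<epsilon>. action v \<sigma> (\<lambda>s. y s + \<epsilon> *\<^sub>R z s)) has_real_derivative
      - (LINT s:{0..1}|lborel. v\<^sup>2 * (y'' s \<bullet> z s))
      + 1 / 2 * (- 2 * (LINT s:{0..1}|lborel. force s \<bullet> z s))) (at 0)"
    unfolding action_def vd
    by (intro DERIV_add DERIV_cmult kinetic_derivative[OF z] interaction_derivative[OF z])
  moreover have "(LINT s:{0..1}|lborel. v\<^sup>2 * (y'' s \<bullet> z s)) + (LINT s:{0..1}|lborel. force s \<bullet> z s)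
      = (LINT s:{0..1}|lborel. (v\<^sup>2 *\<^sub>R y'' s + force s) \<bullet> z s)"
  proof -
    have "set_integrable lborel {0..1} (\<lambda>s. v\<^sup>2 * (y'' s \<bullet> z s))" "set_integrable lborel {0..1} (\<lambda>s. force s \<bullet> z s)"
      by (intro borel_integrable_atLeastAtMost' continuous_intros
          continuous_on_subset[OF cont2] continuous_on_subset[OF continuous_on_force]
          continuous_on_subset[OF z.cont] subset_UNIV)+
    from set_integral_add(2)[OF this] show ?thesis
      by (simp add: inner_add_left)
  qed
  ultimately show ?thesis
    by (elim DERIV_cong) simp
qed

theorem proposition2p2:
  fixes y :: "real \<Rightarrow> real ^ 'd" and \<sigma> v :: real
  assumes "CARD('d) \<ge> 2"
    and "0 < \<sigma>" and "\<sigma> < 1"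
    and "y \<in> C2_periodic"
    and "regular_simple_closed_curve y"
  shows "is_extremal v \<sigma> y \<longleftrightarrow>
    (\<forall>s. \<exists>L.
       ((\<lambda>\<delta>. LINT r:{s + \<delta>..1 + s - \<delta>}|lborel.
            (\<sigma> / norm (y s - y r) powr (2 + \<sigma>)) *\<^sub>R (y s - y r)) \<longlongrightarrow> L) (at_right 0) \<and>
       v\<^sup>2 *\<^sub>R vector_derivative (\<lambda>t. vector_derivative y (at t)) (at s) = - L)"
proof -
  let ?y' = "\<lambda>s. vector_derivative y (at s)"
  let ?y'' = "\<lambda>s. vector_derivative ?y' (at s)"
  interpret periodic_C2 y ?y' ?y''
    by (rule C2_periodic_imp_periodic_C2) fact
  have reg: "?y' s \<noteq> 0" and inj: "inj_on y {0..<1}" for s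
    using assms(5) by (auto simp: regular_simple_closed_curve_def)
  obtain c where c: "c > 0" "\<And>s h. 0 \<le> h \<Longrightarrow> h \<le> 1/2 \<Longrightarrow> c * h \<le> norm (y (s + h) - y s)"
    using chord_arc_bound[OF reg inj] by metis
  interpret chord_arc_curve y ?y' ?y'' c \<sigma>
    by unfold_locales (use c assms(2,3) in auto)
  let ?g = "\<lambda>s. v\<^sup>2 *\<^sub>R ?y'' s + force s"
  let ?PV = "\<lambda>s \<delta>. LINT r:{s + \<delta>..1 + s - \<delta>}|lborel.
    (\<sigma> / norm (y s - y r) powr (2 + \<sigma>)) *\<^sub>R (y s - y r)"
  \<comment> \<open>The derivative always exists, so by uniqueness being extremal means that
    \<open>?g\<close> is orthogonal to all test functions.\<close>
  have "is_extremal v \<sigma> y \<longleftrightarrow> (\<forall>z\<in>C2_periodic. (LINT s:{0..1}|lborel. ?g s \<bullet> z s) = 0)"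
    unfolding is_extremal_def
  proof (intro ball_cong refl)
    fix z :: "real \<Rightarrow> real ^ 'd"
    assume "z \<in> C2_periodic"
    note D = action_derivative[OF chord_arc_curve_axioms C2_periodic_imp_periodic_C2[OF this], of v]
    show "((\<lambda>\<epsilon>. action v \<sigma> (\<lambda>s. y s + \<epsilon> *\<^sub>R z s)) has_real_derivative 0) (at 0)
        \<longleftrightarrow> (LINT s:{0..1}|lborel. ?g s \<bullet> z s) = 0"
      using D DERIV_unique[OF D, of 0] by auto
  qed
  also have "\<dots> \<longleftrightarrow> (\<forall>s. ?g s = 0)"
  proof
    assume orth: "\<forall>z\<in>C2_periodic. (LINT s:{0..1}|lborel. ?g s \<bullet> z s) = 0"
    show "\<forall>s. ?g s = 0"
    proof
      show "?g s = 0" for s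
      proof (rule periodic_fundamental_lemma)
        show "continuous_on UNIV ?g"
          by (intro continuous_intros cont2 continuous_on_force)
        show "?g (s + 1) = ?g s" for s
          by (simp only: periodic2 force_periodic)
        show "(LINT s:{0..1}|lborel. ?g s \<bullet> z s) = 0" if "periodic_C2 z z' z''" for z z' z''
          using orth periodic_C2_imp_C2_periodic[OF that] by blast
      qed
    qed
  qed simp
  \<comment> \<open>The limit exists and equals \<open>force s\<close>; uniqueness of limits
    identifies any \<open>L\<close> with it.\<close>
  also have "\<dots> \<longleftrightarrow> (\<forall>s. \<exists>L. (?PV s \<longlongrightarrow> L) (at_right 0) \<and> v\<^sup>2 *\<^sub>R ?y'' s = - L)"
  proof (intro iff_allI)
    fix s
    note pv = principal_value[of s, unfolded riesz_kernel_def]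
    show "?g s = 0 \<longleftrightarrow> (\<exists>L. (?PV s \<longlongrightarrow> L) (at_right 0) \<and> v\<^sup>2 *\<^sub>R ?y'' s = - L)"
    proof
      assume "?g s = 0"
      with pv show "\<exists>L. (?PV s \<longlongrightarrow> L) (at_right 0) \<and> v\<^sup>2 *\<^sub>R ?y'' s = - L"
        unfolding eq_neg_iff_add_eq_0 by blast
    next
      assume "\<exists>L. (?PV s \<longlongrightarrow> L) (at_right 0) \<and> v\<^sup>2 *\<^sub>R ?y'' s = - L"
      then obtain L where L: "(?PV s \<longlongrightarrow> L) (at_right 0)" "v\<^sup>2 *\<^sub>R ?y'' s = - L"
        by blast
      from tendsto_unique[OF trivial_limit_at_right_real pv L(1)] L(2) show "?g s = 0"
        by simp
    qed
  qed
  finally show ?thesis .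
qed

end
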